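(* Let $K$ and $M$ be integers with $2\le M\le K$. For the PIR-CSI--II setting with $K$ messages and side information support size $M$, the capacity and the scalar-linear capacity are both equal to $1$ if $M=2$ or $M=K$, and both equal to $\frac12$ if $3\le M\le K-1$.
   Context: Setup. Let $\mathcal{K}=\{1,\dots,K\}$, let $q$ be a prime power, $l\ge 1$ an integer, $\mathbb{F}_q^{\times}=\mathbb{F}_q\setminus\{0\}$ and $L=l\log_2 q$. Let $\mathcal{S}$ be the set of all $M$-subsets of $\mathcal{K}$ and $\mathcal{C}$ the set of all length-$M$ sequences over $\mathbb{F}_q^{\times}$. Boldface denotes random variables, regular letters their realizations; entropies are Shannon entropies in bits. A server stores messages $\mathbf{X}_1,\dots,\mathbf{X}_K$, i.i.d. uniform on $\mathbb{F}_{q^l}$ (so $H(\mathbf{X}_i)=L$); write $\mathbf{X}_{\mathcal{K}}=\{\mathbf{X}_1,\dots,\mathbf{X}_K\}$. A user wants $X_W$ ($W\in\mathcal{K}$ is the demand index) and knows the coded side information $Y^{[S,C]}=\sum_{i\in S}c_iX_i$, where $S=\{i_1,\dots,i_M\}\in\mathcal{S}$ (the support index set) and $C=(c_{i_1},\dots,c_{i_M})\in\mathcal{C}$. $\mathbf{S}$ is uniform on $\mathcal{S}$, $\mathbf{C}$ is uniform on $\mathcal{C}$ and independent of $(\mathbf{W},\mathbf{S})$, and the messages are independent of $(\mathbf{W},\mathbf{S},\mathbf{C})$. Model II: given $\mathbf{S}=S$, $\mathbf{W}$ is uniform on $S$ (so the indicator $\mathds{1}_{\{\mathbf{W}\in\mathbf{S}\}}$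 equals $1$). Protocol. The user sends a query $\mathbf{Q}=\mathbf{Q}^{[\mathbf{W},\mathbf{S},\mathbf{C}]}$, a possibly stochastic function of $(\mathbf{W},\mathbf{S},\mathbf{C})$ only (any extra randomness is independent of the messages). The server replies with an answer $\mathbf{A}=\mathbf{A}^{[\mathbf{W},\mathbf{S},\mathbf{C}]}$, a deterministic function of $\mathbf{Q}$, the indicator $\mathds{1}_{\{\mathbf{W}\in\mathbf{S}\}}$ and $\mathbf{X}_{\mathcal{K}}$. Recoverability: $H(\mathbf{X}_{\mathbf{W}}\mid \mathbf{A},\mathbf{Q},\mathds{1}_{\{\mathbf{W}\in\mathbf{S}\}},\mathbf{Y}^{[\mathbf{S},\mathbf{C}]},\mathbf{W},\mathbf{S},\mathbf{C})=0$. $W$-privacy: $I(\mathbf{W};\mathbf{Q}\mid \mathds{1}_{\{\mathbf{W}\in\mathbf{S}\}})=0$. A PIR-CSI--II protocol is a protocol under Model II satisfying recoverability and $W$-privacy. Its rate is $L/H(\mathbf{A}\mid \mathds{1}_{\{\mathbf{W}\in\mathbf{S}\}}=1)$. It is scalar-linear if the answer consists only of linear combinations of $X_1,\dots,X_K$ with coefficients in $\mathbb{F}_q$ (the coefficients being determined by the query). The capacity (resp. scalar-linear capacity) of the setting is the supremum of the rates over all (resp. all scalar-linear) PIR-CSI--II protocols and over all prime powers $q$ and all $l\ge1$. *)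

theory Defs
  imports "HOL-Probability.Probability" "HOL-Algebra.Subrings" "HOL-Number_Theory.Prime_Powers"
begin

text \<open>
  Shannon quantities (in bits) of discrete random variables, i.e. of functions on the outcomes of
  a \<open>pmf\<close>. They are the constants of the locale \<open>information_space\<close>, taken on the probability
  space whose underlying set is the (countable) support of the \<open>pmf\<close>. Without the restriction to
  the support, the counting measures below would in general not be sigma-finite.

  An infinite entropy is \<open>0\<close> under the library definition, because the integral does not exist.
  The only entropy below that can be infinite is that of an answer; see \<open>rate\<close>.
\<close>

definition discrete_space :: "'o pmf \<Rightarrow> 'o measure" where
  "discrete_space p = restrict_space (measure_pmf p) (set_pmf p)"

definition range_space :: "'o pmf \<Rightarrow> ('o \<Rightarrow> 'a) \<Rightarrow> 'a measure" where
  "range_space p X = count_space (X ` space (discrete_space p))"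

definition shannon_entropy :: "'o pmf \<Rightarrow> ('o \<Rightarrow> 'a) \<Rightarrow> real" where
  "shannon_entropy p X = prob_space.entropy (discrete_space p) 2 (range_space p X) X"

definition cond_shannon_entropy :: "'o pmf \<Rightarrow> ('o \<Rightarrow> 'a) \<Rightarrow> ('o \<Rightarrow> 'b) \<Rightarrow> real" where
  "cond_shannon_entropy p X Y =
     prob_space.conditional_entropy (discrete_space p) 2 (range_space p X) (range_space p Y) X Y"

definition cond_mutual_info ::
    "'o pmf \<Rightarrow> ('o \<Rightarrow> 'a) \<Rightarrow> ('o \<Rightarrow> 'b) \<Rightarrow> ('o \<Rightarrow> 'c) \<Rightarrow> real" where
  "cond_mutual_info p X Y Z =
     prob_space.conditional_mutual_information (discrete_space p) 2
       (range_space p X) (range_space p Y) (range_space p Z) X Y Z"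

text \<open>
  \<open>F\<close> plays the role of the field with \<open>q ^ l\<close> elements and \<open>B\<close> that of its subfield with \<open>q\<close>
  elements. Elements are represented by natural numbers, so that \<open>q\<close> and \<open>l\<close> can be quantified in
  the definition of capacity; every finite field has an isomorphic copy of this kind.
\<close>

definition field_setting :: "nat \<Rightarrow> nat \<Rightarrow> nat ring \<Rightarrow> nat set \<Rightarrow> bool" where
  "field_setting q l F B \<longleftrightarrow>
     primepow q \<and> 1 \<le> l \<and> field F \<and> finite (carrier F) \<and> subfield B F \<and>
     card B = q \<and> card (carrier F) = q ^ l"

definition message_vectors :: "nat \<Rightarrow> nat ring \<Rightarrow> (nat \<Rightarrow> nat) set" where
  "message_vectors K F = (\<Pi>\<^sub>E i\<in>{1..K}. carrier F)"

definition support_sets :: "nat \<Rightarrow> nat \<Rightarrow> nat set set" where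
  "support_sets K M = {S. S \<subseteq> {1..K} \<and> card S = M}"

definition coeff_seqs :: "nat \<Rightarrow> nat ring \<Rightarrow> nat set \<Rightarrow> nat list set" where
  "coeff_seqs M F B = {C. length C = M \<and> set C \<subseteq> B - {\<zero>\<^bsub>F\<^esub>}}"

text \<open>The \<open>j\<close>-th coefficient belongs to the \<open>j\<close>-th smallest index of the support.\<close>

definition side_info :: "nat ring \<Rightarrow> nat set \<Rightarrow> nat list \<Rightarrow> (nat \<Rightarrow> nat) \<Rightarrow> nat" where
  "side_info F S C X =
     (\<Oplus>\<^bsub>F\<^esub>j\<in>{..<card S}. (C ! j) \<otimes>\<^bsub>F\<^esub> X (sorted_list_of_set S ! j))"

text \<open>
  A stochastic query is a probability distribution on a countable alphabet for each \<open>(W, S, C)\<close>.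
  An answer is a function of the query, the indicator of \<open>W \<in> S\<close> and the messages. Lists as answers
  impose no restriction on a discrete answer, and a list of field elements is the form taken by a
  scalar-linear answer.
\<close>

record protocol =
  query_kernel :: "nat \<Rightarrow> nat set \<Rightarrow> nat list \<Rightarrow> nat pmf"
  answer_map :: "nat \<Rightarrow> bool \<Rightarrow> (nat \<Rightarrow> nat) \<Rightarrow> nat list"

record outcome =
  demand :: nat
  supp_set :: "nat set"
  coeff_seq :: "nat list"
  query :: nat
  messages :: "nat \<Rightarrow> nat"

definition joint_pmf :: "nat \<Rightarrow> nat \<Rightarrow> nat ring \<Rightarrow> nat set \<Rightarrow> protocol \<Rightarrow> outcome pmf" where
  "joint_pmf K M F B P = do {
     S \<leftarrow> pmf_of_set (support_sets K M);
     W \<leftarrow> pmf_of_set S;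
     C \<leftarrow> pmf_of_set (coeff_seqs M F B);
     Q \<leftarrow> query_kernel P W S C;
     X \<leftarrow> pmf_of_set (message_vectors K F);
     return_pmf \<lparr>demand = W, supp_set = S, coeff_seq = C, query = Q, messages = X\<rparr>
   }"

definition demand_in_support :: "outcome \<Rightarrow> bool" where
  "demand_in_support \<omega> \<longleftrightarrow> demand \<omega> \<in> supp_set \<omega>"

definition demanded_message :: "outcome \<Rightarrow> nat" where
  "demanded_message \<omega> = messages \<omega> (demand \<omega>)"

definition side_information :: "nat ring \<Rightarrow> outcome \<Rightarrow> nat" where
  "side_information F \<omega> = side_info F (supp_set \<omega>) (coeff_seq \<omega>) (messages \<omega>)"

definition answer :: "protocol \<Rightarrow> outcome \<Rightarrow> nat list" where
  "answer P \<omega> = answer_map P (query \<omega>) (demand_in_support \<omega>) (messages \<omega>)"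

definition recoverability :: "nat \<Rightarrow> nat \<Rightarrow> nat ring \<Rightarrow> nat set \<Rightarrow> protocol \<Rightarrow> bool" where
  "recoverability K M F B P \<longleftrightarrow>
     cond_shannon_entropy (joint_pmf K M F B P) demanded_message
       (\<lambda>\<omega>. (answer P \<omega>, query \<omega>, demand_in_support \<omega>, side_information F \<omega>,
             demand \<omega>, supp_set \<omega>, coeff_seq \<omega>)) = 0"

definition W_privacy :: "nat \<Rightarrow> nat \<Rightarrow> nat ring \<Rightarrow> nat set \<Rightarrow> protocol \<Rightarrow> bool" where
  "W_privacy K M F B P \<longleftrightarrow>
     cond_mutual_info (joint_pmf K M F B P) demand query demand_in_support = 0"

definition PIR_CSI_II :: "nat \<Rightarrow> nat \<Rightarrow> nat ring \<Rightarrow> nat set \<Rightarrow> protocol \<Rightarrow> bool" where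
  "PIR_CSI_II K M F B P \<longleftrightarrow> recoverability K M F B P \<and> W_privacy K M F B P"

text \<open>
  The number of linear combinations may depend on the query; each row \<open>v\<close> in the list \<open>V Q\<close>
  contributes one combination to the answer.
\<close>

definition scalar_linear :: "nat \<Rightarrow> nat ring \<Rightarrow> nat set \<Rightarrow> protocol \<Rightarrow> bool" where
  "scalar_linear K F B P \<longleftrightarrow>
     (\<exists>V :: nat \<Rightarrow> (nat \<Rightarrow> nat) list.
        (\<forall>Q. \<forall>v\<in>set (V Q). \<forall>i\<in>{1..K}. v i \<in> B) \<and>
        (\<forall>Q b. \<forall>X\<in>message_vectors K F.
           answer_map P Q b X = map (\<lambda>v. \<Oplus>\<^bsub>F\<^esub>i\<in>{1..K}. v i \<otimes>\<^bsub>F\<^esub> X i) (V Q)))"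

text \<open>
  If the answer has infinite entropy, the denominator is \<open>0\<close> as noted above, and division by zero
  makes the rate \<open>0\<close>, the value of \<open>L / \<infinity>\<close>.
\<close>

definition rate ::
    "nat \<Rightarrow> nat \<Rightarrow> nat \<Rightarrow> nat \<Rightarrow> nat ring \<Rightarrow> nat set \<Rightarrow> protocol \<Rightarrow> real" where
  "rate K M q l F B P =
     (real l * log 2 (real q)) /
     shannon_entropy (cond_pmf (joint_pmf K M F B P) {\<omega>. demand_in_support \<omega>}) (answer P)"

definition capacity :: "nat \<Rightarrow> nat \<Rightarrow> ereal" where
  "capacity K M =
     Sup {ereal (rate K M q l F B P) | q l F B P.
            field_setting q l F B \<and> PIR_CSI_II K M F B P}"

definition scalar_linear_capacity :: "nat \<Rightarrow> nat \<Rightarrow> ereal" where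
  "scalar_linear_capacity K M =
     Sup {ereal (rate K M q l F B P) | q l F B P.
            field_setting q l F B \<and> PIR_CSI_II K M F B P \<and> scalar_linear K F B P}"

end

theory Submission
  imports Defs
begin

text \<open>
  Converse. Privacy makes every demand compatible with every query, so for each query the event
  that the answer has a given value is a set \<open>E\<close> of message vectors on which, for every \<open>W\<close>, some
  side information with support containing \<open>W\<close> determines \<open>X\<^sub>W\<close>. One such \<open>W\<close> costs one dimension of
  \<open>E\<close>. Two of them cost two dimensions unless their supports agree off the two demands, and for
  \<open>3 \<le> M < K\<close> this cannot happen for all pairs. So the min-entropy of the answer, hence its entropy, is
  at least \<open>L\<close>, respectively \<open>2 L\<close>.

  Achievability. The user draws an index \<open>b\<close> uniformly and modifies the coefficient vector \<open>v\<close> at the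
  positions \<open>W\<close> and \<open>b\<close> in such a way that, for each \<open>b\<close>, the vectors of weight \<open>M\<close> with \<open>v\<^sub>W \<noteq> 0\<close> are
  mapped bijectively to those with \<open>u\<^sub>b \<noteq> 0\<close>. Any query that is a function of \<open>b\<close> and the modified
  vector \<open>u\<close> is therefore independent of the demand. Asking for \<open>u \<bullet> X\<close> and \<open>X\<^sub>b\<close> always suffices
  when \<open>2 \<noteq> 0\<close>; \<open>u \<bullet> X\<close> alone suffices if \<open>M = K\<close>, and if \<open>M = 2\<close> it suffices to ask for the message
  at the position other than \<open>b\<close> in the support of \<open>u\<close>.
\<close>

section \<open>Entropies of discrete random variables\<close>

lemma space_discrete_space [simp]: "space (discrete_space p) = set_pmf p"
  by (simp add: discrete_space_def space_restrict_space)

lemma sets_discrete_space [simp]: "sets (discrete_space p) = Pow (set_pmf p)"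
  by (auto simp: discrete_space_def sets_restrict_space image_iff)

lemma emeasure_discrete_space:
  "A \<subseteq> set_pmf p \<Longrightarrow> emeasure (discrete_space p) A = emeasure (measure_pmf p) A"
  by (simp add: discrete_space_def emeasure_restrict_space)

lemma information_space_discrete_space: "information_space (discrete_space p) 2"
proof -
  have "emeasure (measure_pmf p) (set_pmf p) = 1"
    by (simp add: measure_pmf.emeasure_eq_measure measure_pmf.prob_eq_1 AE_measure_pmf)
  then have "prob_space (discrete_space p)"
    by (intro prob_spaceI) (simp add: emeasure_discrete_space)
  then show ?thesis
    by (simp add: information_space_def information_space_axioms_def)
qed

lemma range_space_eq: "range_space p X = count_space (X ` set_pmf p)"
  by (simp add: range_space_def)

text \<open>A countable \<open>R\<close> larger than the image is allowed because a pair of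
  variables is measured on the product of the two images, which may contain pairs that never
  occur.\<close>

lemma distributed_discrete_space:
  assumes "countable R" "X ` set_pmf p \<subseteq> R"
  shows "distributed (discrete_space p) (count_space R) X (pmf (map_pmf X p))"
proof -
  have meas: "X \<in> measurable (discrete_space p) (count_space R)"
    using assms(2) by (auto simp: measurable_def)
  have "distr (discrete_space p) (count_space R) X = density (count_space R) (pmf (map_pmf X p))"
  proof (rule measure_eqI_countable)
    fix a assume a: "a \<in> R"
    have "emeasure (distr (discrete_space p) (count_space R) X) {a}
        = emeasure (measure_pmf p) (X -` {a} \<inter> set_pmf p)"
      using a meas by (simp add: emeasure_distr emeasure_discrete_space)
    also have "\<dots> = emeasure (measure_pmf p) (X -` {a})"
      by (intro emeasure_eq_AE) (auto simp: AE_measure_pmf_iff)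
    also have "\<dots> = pmf (map_pmf X p) a"
      by (simp add: pmf_map measure_pmf.emeasure_eq_measure)
    also have "\<dots> = emeasure (density (count_space R) (pmf (map_pmf X p))) {a}"
      using a by (simp add: emeasure_density nn_integral_indicator_singleton)
    finally show "emeasure (distr (discrete_space p) (count_space R) X) {a}
        = emeasure (density (count_space R) (pmf (map_pmf X p))) {a}" .
  qed (use assms in auto)
  with meas show ?thesis by (simp add: distributed_def)
qed

section \<open>Bounds on the entropy of one variable\<close>

lemma shannon_entropy_eq:
  "shannon_entropy p X = - (\<integral>x. pmf (map_pmf X p) x * log 2 (pmf (map_pmf X p) x) \<partial>count_space (X ` set_pmf p))"
proof -
  interpret information_space "discrete_space p" 2 by (rule information_space_discrete_space)
  show ?thesis unfolding shannon_entropy_def range_space_eq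
    by (rule entropy_distr) (auto intro: distributed_discrete_space)
qed

text \<open>Entropy is the mean of minus the logarithm of the probability, and each such value is at
  least \<open>log 2 N\<close>. Integrability is assumed because a divergent sum would be read as
  \<open>0\<close>.\<close>

lemma shannon_entropy_ge_min_entropy:
  fixes N :: real
  assumes "N > 0" "\<And>x. pmf (map_pmf X p) x \<le> 1 / N"
    and int: "integrable (count_space (X ` set_pmf p)) (\<lambda>x. pmf (map_pmf X p) x * log 2 (pmf (map_pmf X p) x))"
  shows "log 2 N \<le> shannon_entropy p X"
proof -
  let ?R = "X ` set_pmf p" and ?P = "pmf (map_pmf X p)"
  have "(\<integral>x. ?P x \<partial>count_space ?R) = 1"
    by (simp add: integral_pmf measure_pmf.prob_eq_1 AE_measure_pmf_iff)
  \<comment> \<open>Total mass one turns the constant into an integral, so that integrands can be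
    compared pointwise.\<close>
  then have "log 2 N = (\<integral>x. ?P x * log 2 N \<partial>count_space ?R)"
    by simp
  also have "\<dots> \<le> (\<integral>x. - (?P x * log 2 (?P x)) \<partial>count_space ?R)"
  proof (rule integral_mono)
    fix x assume "x \<in> space (count_space ?R)"
    then have "?P x > 0" by (intro pmf_positive) auto
    then have "log 2 (?P x) \<le> log 2 (1 / N)" using assms by simp
    also have "\<dots> = - log 2 N" using assms(1) by (simp add: log_divide)
    finally have "?P x * log 2 N \<le> ?P x * - log 2 (?P x)"
      by (intro mult_left_mono) auto
    then show "?P x * log 2 N \<le> - (?P x * log 2 (?P x))" by simp
  qed (use int in \<open>auto intro: integrable_pmf\<close>)
  finally show ?thesis by (simp add: shannon_entropy_eq)
qed

text \<open>The value \<open>0\<close> stands for an infinite entropy.\<close>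

lemma shannon_entropy_min_entropy_cases:
  fixes N :: real
  assumes "N > 0" "\<And>x. pmf (map_pmf X p) x \<le> 1 / N"
  shows "shannon_entropy p X = 0 \<or> log 2 N \<le> shannon_entropy p X"
  using shannon_entropy_ge_min_entropy[OF assms]
  by (cases "integrable (count_space (X ` set_pmf p)) (\<lambda>x. pmf (map_pmf X p) x * log 2 (pmf (map_pmf X p) x))")
    (auto simp: shannon_entropy_eq not_integrable_integral_eq)

lemma shannon_entropy_le_card:
  assumes "finite R" "X ` set_pmf p \<subseteq> R"
  shows "shannon_entropy p X \<le> log 2 (card R)"
proof -
  interpret information_space "discrete_space p" 2 by (rule information_space_discrete_space)
  have fin: "finite (X ` set_pmf p)" using assms finite_subset by blast
  have "simple_function (discrete_space p) X"
    using fin by (auto simp: simple_function_def)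
  then have "simple_distributed (discrete_space p) X (\<lambda>x. measure (discrete_space p) (X -` {x} \<inter> set_pmf p))"
    by (intro simple_distributedI) auto
  from entropy_le_card[OF this] have "shannon_entropy p X \<le> log 2 (card (X ` set_pmf p))"
    by (simp add: shannon_entropy_def range_space_eq)
  also have "\<dots> \<le> log 2 (card R)"
  proof -
    have "card (X ` set_pmf p) > 0" using fin by (simp add: card_gt_0_iff set_pmf_not_empty)
    then show ?thesis using card_mono[OF assms] by simp
  qed
  finally show ?thesis .
qed

section \<open>When conditional entropy and mutual information vanish\<close>

lemma pmf_map_Pair_le_snd: "pmf (map_pmf (\<lambda>\<omega>. (X \<omega>, Y \<omega>)) p) (x, y) \<le> pmf (map_pmf Y p) y"
  unfolding pmf_map by (intro measure_pmf.finite_measure_mono) auto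

lemma pmf_map_Pair_le_fst: "pmf (map_pmf (\<lambda>\<omega>. (X \<omega>, Y \<omega>)) p) (x, y) \<le> pmf (map_pmf X p) x"
  unfolding pmf_map by (intro measure_pmf.finite_measure_mono) auto

text \<open>The second coordinate stands for a variable that may take infinitely many values, such
  as a query. A finite first coordinate repeats its summable series finitely often, so its marginal
  can dominate integrands on the product.\<close>

lemma integrable_snd_count_space:
  fixes f :: "'b \<Rightarrow> real" and A :: "'a set"
  assumes "finite A" "countable B" "integrable (count_space B) f"
  shows "integrable (count_space (A \<times> B)) (\<lambda>z. f (snd z))"
proof -
  have "Infinite_Set_Sum.abs_summable_on (\<lambda>(x, y). (1::real) * f y) (A \<times> B)"
    using assms by (intro Infinite_Set_Sum.abs_summable_on_product) (auto simp: Infinite_Set_Sum.abs_summable_on_def countable_finite integrable_count_space)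
  then show ?thesis by (simp add: Infinite_Set_Sum.abs_summable_on_def case_prod_beta)
qed

lemma cond_shannon_entropy_eq:
  "cond_shannon_entropy p X Y = - (\<integral>z. pmf (map_pmf (\<lambda>\<omega>. (X \<omega>, Y \<omega>)) p) z *
      log 2 (pmf (map_pmf (\<lambda>\<omega>. (X \<omega>, Y \<omega>)) p) z / pmf (map_pmf Y p) (snd z))
      \<partial>count_space (X ` set_pmf p \<times> Y ` set_pmf p))"
proof -
  interpret information_space "discrete_space p" 2 by (rule information_space_discrete_space)
  have pair: "count_space (X ` set_pmf p) \<Otimes>\<^sub>M count_space (Y ` set_pmf p)
      = count_space (X ` set_pmf p \<times> Y ` set_pmf p)"
    by (simp add: pair_measure_countable)
  show ?thesis unfolding cond_shannon_entropy_def range_space_eq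
    by (subst conditional_entropy_generic_eq[where Py = "pmf (map_pmf Y p)"
          and Pxy = "pmf (map_pmf (\<lambda>\<omega>. (X \<omega>, Y \<omega>)) p)"])
      (auto simp: pair case_prod_beta sigma_finite_measure_count_space_countable
         intro!: distributed_discrete_space Bochner_Integration.integral_cong)
qed

lemma integral_nonneg_eq_0_count_space:
  fixes g :: "'a \<Rightarrow> real"
  assumes "integrable (count_space A) g" "\<And>x. x \<in> A \<Longrightarrow> 0 \<le> g x" "integral\<^sup>L (count_space A) g = 0" "x \<in> A"
  shows "g x = 0"
proof -
  have "AE x in count_space A. g x = 0"
    using assms by (subst integral_nonneg_eq_0_iff_AE[symmetric]) (auto simp: AE_count_space)
  with assms(4) show ?thesis by (simp add: AE_count_space)
qed

text \<open>With \<open>t\<close> a conditional probability, this dominates the terms of a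
  conditional entropy by a constant multiple of a marginal probability.\<close>

lemma neg_mult_ln_le_1:
  fixes t :: real assumes "0 \<le> t" "t \<le> 1" shows "- (t * ln t) \<le> 1"
proof (cases "t = 0")
  case False
  then have "t > 0" using assms by simp
  have "ln (1/t) \<le> 1/t" using ln_le_minus_one[of "1/t"] \<open>t > 0\<close> by simp
  then have "t * ln (1/t) \<le> t * (1/t)" using assms by (intro mult_left_mono) auto
  then show ?thesis using \<open>t > 0\<close> by (simp add: ln_div)
qed simp

text \<open>The sum has nonnegative terms and converges, so it vanishes only if each term does, that
  is, if each conditional probability of a value of \<open>X\<close> given a value of
  \<open>Y\<close> is \<open>0\<close> or \<open>1\<close>. Finiteness of the range of
  \<open>X\<close> gives convergence; a divergent sum would also be read as
  \<open>0\<close>.\<close>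

lemma cond_shannon_entropy_eq_0_iff:
  assumes fin: "finite (X ` set_pmf p)"
  shows "cond_shannon_entropy p X Y = 0 \<longleftrightarrow>
    (\<forall>\<omega>\<in>set_pmf p. \<forall>\<omega>'\<in>set_pmf p. Y \<omega> = Y \<omega>' \<longrightarrow> X \<omega> = X \<omega>')"
proof -
  let ?XY = "\<lambda>\<omega>. (X \<omega>, Y \<omega>)"
  let ?R = "X ` set_pmf p \<times> Y ` set_pmf p"
  let ?J = "pmf (map_pmf ?XY p)" and ?Q = "pmf (map_pmf Y p)"
  define g where "g z = - (?J z * log 2 (?J z / ?Q (snd z)))" for z
  have H: "cond_shannon_entropy p X Y = integral\<^sup>L (count_space ?R) g"
    unfolding cond_shannon_entropy_eq g_def[abs_def] by (rule integral_minus[symmetric])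
  have le: "?J z \<le> ?Q (snd z)" for z
    using pmf_map_Pair_le_snd[of X Y p "fst z" "snd z"] by simp
  have Qpos: "?Q (snd z) > 0" if "z \<in> ?R" for z
    using that by (intro pmf_positive) auto
  have g: "0 \<le> g z" "g z \<le> ?Q (snd z) / ln 2" if "z \<in> ?R" for z
  proof -
    \<comment> \<open>The conditional probability of \<open>fst z\<close> given
      \<open>snd z\<close>.\<close>
    define t where "t = ?J z / ?Q (snd z)"
    have t: "0 \<le> t" "t \<le> 1" using le[of z] Qpos[OF that] by (auto simp: t_def)
    have gt: "g z = ?Q (snd z) / ln 2 * (- (t * ln t))"
      using Qpos[OF that] by (simp add: g_def t_def log_def)
    have "0 \<le> - (t * ln t)" using t by (cases "t = 0") (auto simp: mult_le_0_iff)
    then show "0 \<le> g z" unfolding gt by (intro mult_nonneg_nonneg) auto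
    have "?Q (snd z) / ln 2 * (- (t * ln t)) \<le> ?Q (snd z) / ln 2 * 1"
      using neg_mult_ln_le_1[OF t] by (intro mult_left_mono) auto
    then show "g z \<le> ?Q (snd z) / ln 2" unfolding gt by simp
  qed
  have "integrable (count_space ?R) (\<lambda>z. ?Q (snd z) / ln 2)"
    by (intro integrable_divide integrable_snd_count_space fin integrable_pmf) simp
  then have int: "integrable (count_space ?R) g"
    by (rule Bochner_Integration.integrable_bound) (use g in \<open>auto simp: AE_count_space\<close>)
  have "integral\<^sup>L (count_space ?R) g = 0 \<longleftrightarrow> (\<forall>z\<in>?R. g z = 0)"
    using integral_nonneg_eq_0_count_space[OF int g(1)]
    by (auto intro!: integral_eq_zero_AE simp: AE_count_space)
  also have "\<dots> \<longleftrightarrow> (\<forall>z\<in>?R. ?J z = 0 \<or> ?J z = ?Q (snd z))"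
  proof (intro ball_cong refl)
    fix z assume "z \<in> ?R"
    from Qpos[OF this] pmf_nonneg[of "map_pmf ?XY p" z]
    show "g z = 0 \<longleftrightarrow> ?J z = 0 \<or> ?J z = ?Q (snd z)"
      by (cases "?J z = 0") (auto simp: g_def log_def less_le)
  qed
  also have "\<dots> \<longleftrightarrow> (\<forall>\<omega>\<in>set_pmf p. \<forall>\<omega>'\<in>set_pmf p. Y \<omega> = Y \<omega>' \<longrightarrow> X \<omega> = X \<omega>')"
  proof safe
    fix \<omega> \<omega>' assume *: "\<forall>z\<in>?R. ?J z = 0 \<or> ?J z = ?Q (snd z)" "\<omega> \<in> set_pmf p" "\<omega>' \<in> set_pmf p" "Y \<omega> = Y \<omega>'"
    have pos: "?J (?XY \<omega>) > 0" "?J (?XY \<omega>') > 0"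
      using *(2,3) by (auto intro!: pmf_positive)
    then have "?J (?XY \<omega>) = ?Q (Y \<omega>)" using * by fastforce
    show "X \<omega> = X \<omega>'"
    proof (rule ccontr)
      assume ne: "X \<omega> \<noteq> X \<omega>'"
      \<comment> \<open>The two events are disjoint and lie in the event that \<open>Y\<close> takes
        this value, whose mass the first one already exhausts.\<close>
      have "?J (?XY \<omega>) + ?J (?XY \<omega>') = measure p (?XY -` {?XY \<omega>} \<union> ?XY -` {?XY \<omega>'})"
        unfolding pmf_map using ne by (intro measure_pmf.finite_measure_Union[symmetric]) auto
      also have "\<dots> \<le> ?Q (Y \<omega>)"
        unfolding pmf_map using *(4) by (intro measure_pmf.finite_measure_mono) auto
      finally show False using pos \<open>?J (?XY \<omega>) = ?Q (Y \<omega>)\<close> by simp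
    qed
  next
    fix \<omega> \<omega>' assume *: "\<forall>\<omega>\<in>set_pmf p. \<forall>\<omega>'\<in>set_pmf p. Y \<omega> = Y \<omega>' \<longrightarrow> X \<omega> = X \<omega>'"
      "\<omega> \<in> set_pmf p" "\<omega>' \<in> set_pmf p" "?J (X \<omega>, Y \<omega>') \<noteq> ?Q (snd (X \<omega>, Y \<omega>'))"
    show "?J (X \<omega>, Y \<omega>') = 0"
    proof (rule ccontr)
      \<comment> \<open>Positive joint mass yields one outcome realising both values; the functional
        dependence then fixes \<open>X\<close> on the whole fibre of \<open>Y\<close>.\<close>
      assume "?J (X \<omega>, Y \<omega>') \<noteq> 0"
      then have "(X \<omega>, Y \<omega>') \<in> ?XY ` set_pmf p" by (auto simp: pmf_eq_0_set_pmf)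
      then obtain \<omega>'' where "\<omega>'' \<in> set_pmf p" "X \<omega>'' = X \<omega>" "Y \<omega>'' = Y \<omega>'" by auto
      then have "X \<omega> = X \<omega>'" using *(1,3) by metis
      have "X \<omega>'' = X \<omega>" if "\<omega>'' \<in> set_pmf p" "Y \<omega>'' = Y \<omega>'" for \<omega>''
        using *(1,3) that \<open>X \<omega> = X \<omega>'\<close> by metis
      then have "?J (X \<omega>, Y \<omega>') = ?Q (Y \<omega>')"
        unfolding pmf_map
        by (intro measure_pmf.finite_measure_eq_AE) (auto simp: AE_measure_pmf_iff)
      with *(4) show False by simp
    qed
  qed
  finally show ?thesis unfolding H .
qed

text \<open>Mutual information is the divergence of the joint distribution from the product of the
  marginals, and a divergence vanishes only for equal distributions. \<open>R\<close> is left free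
  so that it can be a product of ranges when \<open>Y\<close> is itself a pair.\<close>

lemma mutual_information_discrete_space:
  fixes p :: "'o pmf" and X :: "'o \<Rightarrow> 'a" and Y :: "'o \<Rightarrow> 'b"
  assumes fin: "finite (X ` set_pmf p)" and R: "countable R" "Y ` set_pmf p \<subseteq> R"
  defines "I \<equiv> prob_space.mutual_information (discrete_space p) 2 (range_space p X) (count_space R) X Y"
  shows "I = 0 \<longleftrightarrow>
    (\<forall>x y. pmf (map_pmf (\<lambda>\<omega>. (X \<omega>, Y \<omega>)) p) (x, y) = pmf (map_pmf X p) x * pmf (map_pmf Y p) y)"
proof -
  interpret information_space "discrete_space p" 2 by (rule information_space_discrete_space)
  let ?XY = "\<lambda>\<omega>. (X \<omega>, Y \<omega>)"
  let ?A = "X ` set_pmf p \<times> R"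
  let ?J = "pmf (map_pmf ?XY p)" and ?P = "pmf (map_pmf X p)" and ?Q = "pmf (map_pmf Y p)"
  define f where "f z = ?J z * ln (?J z / (?P (fst z) * ?Q (snd z)))" for z
  \<comment> \<open>With \<open>t\<close> the quotient of product and joint probability,
    \<open>g\<close> is the joint probability times \<open>t - 1 - ln t\<close>. So it is
    nonnegative pointwise, which \<open>f\<close> need not be.\<close>
  define g where "g z = f z - ?J z + ?P (fst z) * ?Q (snd z)" for z
  have pair: "range_space p X \<Otimes>\<^sub>M count_space R = count_space ?A"
    using R by (simp add: pair_measure_countable range_space_eq)
  have "I = (\<integral>z. ?J z * log 2 (?J z / (?P (fst z) * ?Q (snd z))) \<partial>(range_space p X \<Otimes>\<^sub>M count_space R))"
    unfolding I_def
  proof (rule mutual_information_distr)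
    show "distributed (discrete_space p) (range_space p X) X ?P"
      unfolding range_space_eq by (rule distributed_discrete_space) auto
    show "distributed (discrete_space p) (count_space R) Y ?Q"
      using R by (rule distributed_discrete_space)
    show "distributed (discrete_space p) (range_space p X \<Otimes>\<^sub>M count_space R) ?XY ?J"
      unfolding pair using R by (intro distributed_discrete_space) auto
  qed (simp_all add: range_space_eq sigma_finite_measure_count_space_countable R)
  also have "\<dots> = (\<integral>z. f z / ln 2 \<partial>count_space ?A)"
    by (simp add: pair f_def log_def)
  finally have I: "I = integral\<^sup>L (count_space ?A) f / ln 2" by simp
  have le: "?J z \<le> ?Q (snd z)" "?J z \<le> ?P (fst z)" for z
    using pmf_map_Pair_le_snd[of X Y p "fst z" "snd z"] pmf_map_Pair_le_fst[of X Y p "fst z" "snd z"]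
    by simp_all
  have int_Q: "integrable (count_space ?A) (\<lambda>z. ?Q (snd z))"
    by (intro integrable_snd_count_space fin integrable_pmf R)
  have int_PQ: "integrable (count_space ?A) (\<lambda>z. ?P (fst z) * ?Q (snd z))"
    by (rule Bochner_Integration.integrable_bound[OF int_Q])
      (auto simp: AE_count_space abs_mult pmf_le_1 mult_left_le_one_le)
  have int_J: "integrable (count_space ?A) ?J" by (rule integrable_pmf)
  have g_nonneg: "0 \<le> g z" and g_0: "g z = 0 \<longleftrightarrow> ?J z = ?P (fst z) * ?Q (snd z)" for z
  proof -
    let ?t = "?P (fst z) * ?Q (snd z) / ?J z"
    have "0 \<le> g z \<and> (g z = 0 \<longleftrightarrow> ?J z = ?P (fst z) * ?Q (snd z))"
    proof (cases "?J z = 0")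
      case True
      then show ?thesis by (simp add: g_def f_def)
    next
      case False
      then have J: "?J z > 0" using pmf_nonneg[of "map_pmf ?XY p" z] by linarith
      then have pos: "?P (fst z) > 0" "?Q (snd z) > 0" using le[of z] by auto
      have t: "?t > 0" using J pos by simp
      have g: "g z = ?J z * (?t - 1 - ln ?t)"
        using J pos by (simp add: g_def f_def ln_div ln_mult field_simps)
      have "ln ?t \<le> ?t - 1" using ln_le_minus_one[OF t] .
      moreover have "ln ?t = ?t - 1 \<longleftrightarrow> ?t = 1" using ln_eq_minus_one[OF t] by auto
      ultimately show ?thesis using J by (auto simp: g)
    qed
    then show "0 \<le> g z" "g z = 0 \<longleftrightarrow> ?J z = ?P (fst z) * ?Q (snd z)" by auto
  qed
  \<comment> \<open>A common bound for \<open>1 / ?P x\<close> over the finitely many values of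
    \<open>X\<close>. It bounds \<open>f\<close> from above, while \<open>0 \<le> g z\<close> bounds
    \<open>f\<close> from below.\<close>
  define c where "c = (\<Sum>x\<in>X ` set_pmf p. 1 / ?P x)"
  have f_le: "f z \<le> ?J z * c" if "z \<in> ?A" for z
  proof (cases "?J z = 0")
    case False
    then have J: "?J z > 0" using pmf_nonneg[of "map_pmf ?XY p" z] by linarith
    then have pos: "?P (fst z) > 0" "?Q (snd z) > 0" using le[of z] by auto
    have "ln (?J z / (?P (fst z) * ?Q (snd z))) \<le> ?J z / (?P (fst z) * ?Q (snd z))"
      using ln_le_minus_one[of "?J z / (?P (fst z) * ?Q (snd z))"] J pos by simp
    also have "\<dots> \<le> 1 / ?P (fst z)" using le(1)[of z] pos by (simp add: field_simps)
    also have "\<dots> \<le> c" unfolding c_def using fin that by (intro member_le_sum) auto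
    finally show ?thesis unfolding f_def by (intro mult_left_mono) auto
  qed (simp add: f_def)
  have "integrable (count_space ?A) (\<lambda>z. ?J z * c + ?J z + ?P (fst z) * ?Q (snd z))"
    using int_J int_PQ by auto
  then have int_f: "integrable (count_space ?A) f"
  proof (rule Bochner_Integration.integrable_bound)
    show "AE z in count_space ?A. norm (f z) \<le> norm (?J z * c + ?J z + ?P (fst z) * ?Q (snd z))"
    proof (simp only: AE_count_space, intro ballI)
      fix z assume z: "z \<in> ?A"
      have "c \<ge> 0" by (auto simp: c_def intro!: sum_nonneg)
      then have "0 \<le> ?J z * c" "0 \<le> ?J z" "0 \<le> ?P (fst z) * ?Q (snd z)" by auto
      with f_le[OF z] g_nonneg[of z] show "norm (f z) \<le> norm (?J z * c + ?J z + ?P (fst z) * ?Q (snd z))"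
        unfolding g_def real_norm_def by linarith
    qed
  qed simp
  \<comment> \<open>Joint and product distribution both have total mass one on \<open>?A\<close>, so
    \<open>f\<close> and \<open>g\<close> have the same integral.\<close>
  have "(\<integral>z. ?J z \<partial>count_space ?A) = 1"
    using R by (auto simp: integral_pmf measure_pmf.prob_eq_1 AE_measure_pmf_iff)
  moreover have "(\<integral>z. ?P (fst z) * ?Q (snd z) \<partial>count_space ?A) = 1"
  proof -
    have "(\<lambda>z. ?P (fst z) * ?Q (snd z)) = pmf (pair_pmf (map_pmf X p) (map_pmf Y p))"
      by (auto simp: pmf_pair fun_eq_iff)
    then show ?thesis
      using R by (auto simp: integral_pmf measure_pmf.prob_eq_1 AE_measure_pmf_iff)
  qed
  ultimately have "integral\<^sup>L (count_space ?A) f = integral\<^sup>L (count_space ?A) g"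
    unfolding g_def using int_f int_J int_PQ by simp
  moreover have "integral\<^sup>L (count_space ?A) g = 0 \<longleftrightarrow> (\<forall>z\<in>?A. g z = 0)"
  proof -
    have int_g: "integrable (count_space ?A) g"
      unfolding g_def using int_f int_J int_PQ by simp
    show ?thesis
      using integral_nonneg_eq_0_count_space[OF int_g g_nonneg]
      by (auto intro!: integral_eq_zero_AE simp: AE_count_space)
  qed
  moreover have "(\<forall>z\<in>?A. g z = 0) \<longleftrightarrow> (\<forall>x y. ?J (x, y) = ?P x * ?Q y)"
  proof safe
    fix x y assume *: "\<forall>z\<in>?A. g z = 0"
    show "?J (x, y) = ?P x * ?Q y"
    proof (cases "(x, y) \<in> ?A")
      case True
      with * have "g (x, y) = 0" by blast
      then show ?thesis by (simp add: g_0)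
    next
      case False
      then have "?P x = 0 \<or> ?Q y = 0" using R by (auto simp: pmf_eq_0_set_pmf)
      then show ?thesis using le[of "(x, y)"] pmf_nonneg[of "map_pmf ?XY p" "(x, y)"] by auto
    qed
  next
    fix x y assume "\<forall>x y. ?J (x, y) = ?P x * ?Q y"
    then show "g (x, y) = 0" by (simp add: g_0)
  qed
  ultimately show ?thesis by (simp add: I)
qed

text \<open>Conditional mutual information is the difference of I(X;(Y,Z)) and I(X;Z). If
  \<open>Z\<close> is constant, as the indicator is in Model II, the second term is \<open>0\<close>
  and the first vanishes exactly when \<open>X\<close> and \<open>Y\<close> are independent.\<close>

lemma cond_mutual_info_eq_0_iff:
  fixes p :: "'o pmf"
  assumes fin: "finite (X ` set_pmf p)" and const: "\<And>\<omega>. \<omega> \<in> set_pmf p \<Longrightarrow> Z \<omega> = z"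
  shows "cond_mutual_info p X Y Z = 0 \<longleftrightarrow>
    (\<forall>x y. pmf (map_pmf (\<lambda>\<omega>. (X \<omega>, Y \<omega>)) p) (x, y) = pmf (map_pmf X p) x * pmf (map_pmf Y p) y)"
proof -
  interpret information_space "discrete_space p" 2 by (rule information_space_discrete_space)
  have Z: "Z ` set_pmf p = {z}" using const set_pmf_not_empty[of p] by auto
  have Q_Z: "pmf (map_pmf Z p) z' = (if z' = z then 1 else 0)" for z'
  proof -
    have "map_pmf Z p = map_pmf (\<lambda>_. z) p" using const by (intro map_pmf_cong) auto
    then show ?thesis by (simp add: pmf_return)
  qed
  have J_Z: "pmf (map_pmf (\<lambda>\<omega>. (V \<omega>, Z \<omega>)) p) (v, z') = (if z' = z then pmf (map_pmf V p) v else 0)"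
    for V :: "'o \<Rightarrow> 'e" and v z'
  proof -
    have "map_pmf (\<lambda>\<omega>. (V \<omega>, Z \<omega>)) p = map_pmf (\<lambda>\<omega>. (V \<omega>, z)) p"
      using const by (intro map_pmf_cong) auto
    then show ?thesis by (simp add: pmf_map vimage_def)
  qed
  have J_YZ: "pmf (map_pmf (\<lambda>\<omega>. (X \<omega>, Y \<omega>, Z \<omega>)) p) (x, y, z')
      = (if z' = z then pmf (map_pmf (\<lambda>\<omega>. (X \<omega>, Y \<omega>)) p) (x, y) else 0)" for x y z'
    using J_Z[of "\<lambda>\<omega>. (X \<omega>, Y \<omega>)" "(x, y)" z']
    by (auto simp: pmf_map vimage_def split: if_splits)
  have MI_Z: "mutual_information 2 (range_space p X) (range_space p Z) X Z = 0"
    unfolding range_space_eq[of p Z] using J_Z[of X]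
    by (subst mutual_information_discrete_space) (auto simp: fin Z Q_Z)
  have pair: "range_space p Y \<Otimes>\<^sub>M range_space p Z = count_space (Y ` set_pmf p \<times> {z})"
    by (simp add: range_space_eq pair_measure_countable Z)
  have "mutual_information 2 (range_space p X) (range_space p Y \<Otimes>\<^sub>M range_space p Z) X (\<lambda>\<omega>. (Y \<omega>, Z \<omega>)) = 0
      \<longleftrightarrow> (\<forall>x y. pmf (map_pmf (\<lambda>\<omega>. (X \<omega>, Y \<omega>)) p) (x, y) = pmf (map_pmf X p) x * pmf (map_pmf Y p) y)"
    unfolding pair using J_Z[of Y] J_YZ const
    by (subst mutual_information_discrete_space) (auto simp: fin Z)
  with MI_Z show ?thesis
    by (simp add: cond_mutual_info_def conditional_mutual_information_def)
qed

section \<open>Side information and the size of answer fibres\<close>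

locale pir_field = field F for F :: "nat ring" (structure) +
  fixes q l :: nat and B :: "nat set"
  assumes field_setting: "field_setting q l F B"
begin

section \<open>Linear forms in the messages\<close>

definition dot :: "nat \<Rightarrow> (nat \<Rightarrow> nat) \<Rightarrow> (nat \<Rightarrow> nat) \<Rightarrow> nat" where
  "dot K v X = (\<Oplus>i\<in>{1..K}. v i \<otimes> X i)"

text \<open>Extension by zero turns support and coefficients into one vector, so that side
  information is a linear form and a coefficient can change its position without reindexing.\<close>

definition coeff_vec :: "nat set \<Rightarrow> nat list \<Rightarrow> nat \<Rightarrow> nat" where
  "coeff_vec S C i = (if i \<in> S then the (map_of (zip (sorted_list_of_set S) C) i) else \<zero>)"

lemma subfield_B: "subfield B F" and B_subset: "B \<subseteq> carrier F" and finite_F: "finite (carrier F)"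
  and card_F: "card (carrier F) = q ^ l" and l_ge: "1 \<le> l"
  using field_setting subfieldE(3)[of B F] by (auto simp: field_setting_def)

lemma B_closed: "x \<in> B \<Longrightarrow> x \<in> carrier F" using B_subset by auto

lemma zero_B: "\<zero> \<in> B" and one_B: "\<one> \<in> B" and uminus_B: "x \<in> B \<Longrightarrow> \<ominus> x \<in> B"
  using subringE[OF subfieldE(1)[OF subfield_B]] by auto

lemma q_gt_1: "1 < q"
  using field_setting primepow_gt_Suc_0 by (simp add: field_setting_def)

lemma card_F_gt_1: "1 < card (carrier F)"
  unfolding card_F using q_gt_1 l_ge by (intro one_less_power) auto

lemma finite_message_vectors: "finite (message_vectors K F)"
  and message_vectors_nonempty: "message_vectors K F \<noteq> {}"
  using finite_F carrier_not_empty by (auto simp: message_vectors_def PiE_eq_empty_iff intro!: finite_PiE)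

lemma card_message_vectors: "card (message_vectors K F) = card (carrier F) ^ K"
  by (simp add: message_vectors_def card_PiE)

lemma message_closed: "X \<in> message_vectors K F \<Longrightarrow> i \<in> {1..K} \<Longrightarrow> X i \<in> carrier F"
  by (auto simp: message_vectors_def)

lemma dot_closed:
  "v \<in> {1..K} \<rightarrow> carrier F \<Longrightarrow> X \<in> {1..K} \<rightarrow> carrier F \<Longrightarrow> dot K v X \<in> carrier F"
  unfolding dot_def by (intro finsum_closed) auto

lemma finsum_split:
  assumes "finite A" "w \<in> A" "f \<in> A \<rightarrow> carrier F"
  shows "finsum F f A = f w \<oplus> finsum F f (A - {w})"
proof -
  have "finsum F f (insert w (A - {w})) = f w \<oplus> finsum F f (A - {w})"
    using assms by (intro finsum_insert) auto
  then show ?thesis using assms(2) by (simp add: insert_absorb)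
qed

lemma dot_diff_eq_0:
  assumes "v \<in> {1..K} \<rightarrow> carrier F" "X \<in> {1..K} \<rightarrow> carrier F" "X' \<in> {1..K} \<rightarrow> carrier F"
    and "dot K v X = dot K v X'"
  shows "dot K v (\<lambda>i. X i \<ominus> X' i) = \<zero>"
proof -
  \<comment> \<open>Adding \<open>dot K v X'\<close> back reduces the claim to additivity of sums
    and one cancellation.\<close>
  have "dot K v (\<lambda>i. X i \<ominus> X' i) \<oplus> dot K v X' = (\<Oplus>i\<in>{1..K}. v i \<otimes> (X i \<ominus> X' i) \<oplus> v i \<otimes> X' i)"
    unfolding dot_def using assms by (intro finsum_addf[symmetric]) (auto simp: Pi_iff)
  also have "\<dots> = dot K v X"
    unfolding dot_def
  proof (intro finsum_cong')
    fix i assume "i \<in> {1..K}"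
    then have "v i \<in> carrier F" "X i \<in> carrier F" "X' i \<in> carrier F" using assms by auto
    then show "v i \<otimes> (X i \<ominus> X' i) \<oplus> v i \<otimes> X' i = v i \<otimes> X i" by algebra
  qed (use assms in auto)
  finally have "dot K v (\<lambda>i. X i \<ominus> X' i) \<oplus> dot K v X' = \<zero> \<oplus> dot K v X'"
    using assms by (simp add: dot_closed)
  then show ?thesis
    using assms by (subst (asm) add.right_cancel) (auto intro!: dot_closed simp: Pi_iff)
qed

text \<open>The decoding principle: subtracting the two equations leaves
  \<open>(v w - u w) * D w = 0\<close>, since every other term is cancelled by
  \<open>u i = v i\<close> or killed by \<open>D i = \<zero>\<close>.\<close>

lemma dot_eq_0_cancel:
  assumes "v \<in> {1..K} \<rightarrow> carrier F" "u \<in> {1..K} \<rightarrow> carrier F" "D \<in> {1..K} \<rightarrow> carrier F"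
    and "dot K v D = \<zero>" "dot K u D = \<zero>" and w: "w \<in> {1..K}" "v w \<noteq> u w"
    and eq: "\<And>i. i \<in> {1..K} \<Longrightarrow> i \<noteq> w \<Longrightarrow> D i = \<zero> \<or> u i = v i"
  shows "D w = \<zero>"
proof -
  define R where "R = (\<Oplus>i\<in>{1..K} - {w}. v i \<otimes> D i)"
  have R: "R \<in> carrier F" unfolding R_def using assms by (intro finsum_closed) (auto simp: Pi_iff)
  have v: "dot K v D = v w \<otimes> D w \<oplus> R"
    unfolding dot_def R_def using assms by (intro finsum_split) (auto simp: Pi_iff)
  have "dot K u D = u w \<otimes> D w \<oplus> (\<Oplus>i\<in>{1..K} - {w}. u i \<otimes> D i)"
    unfolding dot_def using assms by (intro finsum_split) (auto simp: Pi_iff)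
  also have "(\<Oplus>i\<in>{1..K} - {w}. u i \<otimes> D i) = R"
    unfolding R_def
  proof (intro finsum_cong')
    fix i assume "i \<in> {1..K} - {w}"
    with eq[of i] assms(1-3) show "u i \<otimes> D i = v i \<otimes> D i" by (auto simp: Pi_iff)
  qed (use assms in \<open>auto simp: Pi_iff\<close>)
  finally have u: "dot K u D = u w \<otimes> D w \<oplus> R" .
  have cl: "v w \<in> carrier F" "u w \<in> carrier F" "D w \<in> carrier F" using assms w by (auto simp: Pi_iff)
  have "v w \<otimes> D w \<oplus> R = u w \<otimes> D w \<oplus> R" using u v assms by simp
  then have "v w \<otimes> D w = u w \<otimes> D w" using cl R by (subst (asm) add.right_cancel) auto
  then show ?thesis using m_rcancel[of "D w" "v w" "u w"] cl w by auto
qed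

lemma dot_zero: "dot K (\<lambda>_. \<zero>) D = \<zero>" if "D \<in> {1..K} \<rightarrow> carrier F"
  unfolding dot_def using that by (intro add.finprod_one_eqI) (auto simp: Pi_iff)

lemma dot_unit:
  assumes "D \<in> {1..K} \<rightarrow> carrier F" "i \<in> {1..K}"
  shows "dot K (\<lambda>j. if j = i then \<one> else \<zero>) D = D i"
proof -
  have "dot K (\<lambda>j. if j = i then \<one> else \<zero>) D
      = (if i = i then \<one> else \<zero>) \<otimes> D i \<oplus> (\<Oplus>j\<in>{1..K} - {i}. (if j = i then \<one> else \<zero>) \<otimes> D j)"
    unfolding dot_def using assms by (intro finsum_split) (auto simp: Pi_iff)
  also have "(\<Oplus>j\<in>{1..K} - {i}. (if j = i then \<one> else \<zero>) \<otimes> D j) = \<zero>"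
    using assms by (intro add.finprod_one_eqI) (auto simp: Pi_iff)
  finally show ?thesis using assms by (auto simp: Pi_iff)
qed

section \<open>Side information as a linear form\<close>

lemma support_setsD:
  assumes "S \<in> support_sets K M"
  shows "S \<subseteq> {1..K}" "card S = M" "finite S"
  using assms by (auto simp: support_sets_def intro: finite_subset)

lemma coeff_vec_nth:
  assumes "finite S" "length C = card S" "j < card S"
  shows "coeff_vec S C (sorted_list_of_set S ! j) = C ! j"
proof -
  have "sorted_list_of_set S ! j \<in> S"
    using assms nth_mem[of j "sorted_list_of_set S"] by simp
  then show ?thesis
    using assms by (simp add: coeff_vec_def map_of_zip_nth)
qed

lemma coeff_vec_in:
  assumes S: "S \<in> support_sets K M" and C: "C \<in> coeff_seqs M F B"
  shows "i \<in> S \<Longrightarrow> coeff_vec S C i \<in> B - {\<zero>}" "coeff_vec S C i \<in> B"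
    "coeff_vec S C i = \<zero> \<longleftrightarrow> i \<notin> S"
proof -
  have *: "coeff_vec S C i \<in> B - {\<zero>}" if i: "i \<in> S"
  proof -
    have "i \<in> set (sorted_list_of_set S)" using i support_setsD[OF S] by simp
    then obtain j where j: "j < card S" "i = sorted_list_of_set S ! j"
      by (auto simp: in_set_conv_nth)
    have "coeff_vec S C i = C ! j"
      using coeff_vec_nth[of S C j] j support_setsD[OF S] C by (simp add: coeff_seqs_def)
    moreover have "C ! j \<in> B - {\<zero>}"
    proof -
      have "C ! j \<in> set C" using C j support_setsD[OF S] by (simp add: coeff_seqs_def)
      with C show ?thesis unfolding coeff_seqs_def by blast
    qed
    ultimately show ?thesis by simp
  qed
  show "i \<in> S \<Longrightarrow> coeff_vec S C i \<in> B - {\<zero>}" by (rule *)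
  show "coeff_vec S C i \<in> B"
    using * zero_B by (cases "i \<in> S") (auto simp: coeff_vec_def)
  show "coeff_vec S C i = \<zero> \<longleftrightarrow> i \<notin> S"
    using * by (cases "i \<in> S") (auto simp: coeff_vec_def)
qed

lemma side_info_eq_dot:
  assumes S: "S \<in> support_sets K M" and C: "C \<in> coeff_seqs M F B"
    and X: "X \<in> {1..K} \<rightarrow> carrier F"
  shows "side_info F S C X = dot K (coeff_vec S C) X"
proof -
  note Sd = support_setsD[OF S]
  have len: "length C = card S" using C Sd by (simp add: coeff_seqs_def)
  let ?s = "\<lambda>j. sorted_list_of_set S ! j"
  have img: "?s ` {..<card S} = S"
  proof -
    have "?s ` {..<card S} = set (sorted_list_of_set S)"
      by (auto simp: set_conv_nth image_iff)
    then show ?thesis using Sd by simp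
  qed
  have inj: "inj_on ?s {..<card S}"
    using Sd by (auto simp: inj_on_def nth_eq_iff_index_eq)
  have cl: "coeff_vec S C i \<otimes> X i \<in> carrier F" if "i \<in> {1..K}" for i
    using that X coeff_vec_in(2)[OF S C, of i] by (auto simp: Pi_iff B_closed)
  have "side_info F S C X = (\<Oplus>j\<in>{..<card S}. coeff_vec S C (?s j) \<otimes> X (?s j))"
    unfolding side_info_def
  proof (intro finsum_cong')
    show "(\<lambda>j. coeff_vec S C (?s j) \<otimes> X (?s j)) \<in> {..<card S} \<rightarrow> carrier F"
      using cl img Sd(1) by blast
  qed (simp_all add: coeff_vec_nth[OF Sd(3) len])
  also have "\<dots> = (\<Oplus>i\<in>?s ` {..<card S}. coeff_vec S C i \<otimes> X i)"
    using cl Sd inj img by (intro finsum_reindex[symmetric]) auto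
  also have "\<dots> = dot K (coeff_vec S C) X"
    unfolding img dot_def using Sd X cl
    by (intro add.finprod_mono_neutral_cong_left) (auto simp: coeff_vec_def Pi_iff)
  finally show ?thesis .
qed

text \<open>The coefficient of \<open>k\<close> is nonzero and all other terms agree. This is
  \<open>dot_eq_0_cancel\<close> for the difference of the two vectors, with the zero vector as
  second form.\<close>

lemma side_info_cancel:
  assumes S: "S \<in> support_sets K M" and C: "C \<in> coeff_seqs M F B"
    and X: "X \<in> message_vectors K F" "X' \<in> message_vectors K F"
    and eq: "side_info F S C X = side_info F S C X'"
    and k: "k \<in> S" "\<And>i. i \<in> S \<Longrightarrow> i \<noteq> k \<Longrightarrow> X i = X' i"
  shows "X k = X' k"
proof -
  note Sd = support_setsD[OF S]
  let ?v = "coeff_vec S C"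
  have X': "X \<in> {1..K} \<rightarrow> carrier F" "X' \<in> {1..K} \<rightarrow> carrier F"
    using X message_closed by auto
  have v: "?v \<in> {1..K} \<rightarrow> carrier F" using coeff_vec_in(2)[OF S C] B_closed by auto
  have D: "(\<lambda>i. X i \<ominus> X' i) \<in> {1..K} \<rightarrow> carrier F" using X' by auto
  have "X k \<ominus> X' k = \<zero>"
  proof (rule dot_eq_0_cancel[OF v _ D])
    show "dot K ?v (\<lambda>i. X i \<ominus> X' i) = \<zero>"
      using eq X' by (intro dot_diff_eq_0 v X') (simp only: side_info_eq_dot[OF S C])
    show "dot K (\<lambda>_. \<zero>) (\<lambda>i. X i \<ominus> X' i) = \<zero>" by (rule dot_zero[OF D])
    show "k \<in> {1..K}" using k Sd by auto
    show "?v k \<noteq> \<zero>" using coeff_vec_in(3)[OF S C] k by simp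
    fix i assume i: "i \<in> {1..K}" "i \<noteq> k"
    show "X i \<ominus> X' i = \<zero> \<or> \<zero> = ?v i"
      using k(2)[of i] i X' by (cases "i \<in> S") (auto simp: coeff_vec_def Pi_iff minus_eq r_neg)
  qed auto
  then show ?thesis using X' k Sd by (auto simp: Pi_iff r_right_minus_eq)
qed

lemma side_info_closed:
  assumes S: "S \<in> support_sets K M" and C: "C \<in> coeff_seqs M F B" and X: "X \<in> message_vectors K F"
  shows "side_info F S C X \<in> carrier F"
  using side_info_eq_dot[OF S C, of X] message_closed[OF X] coeff_vec_in(2)[OF S C] B_closed
  by (auto intro!: dot_closed)

section \<open>Counting message vectors that share an answer\<close>

definition determines :: "(nat \<Rightarrow> nat) set \<Rightarrow> nat \<Rightarrow> nat set \<Rightarrow> nat list \<Rightarrow> bool" where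
  "determines E W S C \<longleftrightarrow>
     (\<forall>X\<in>E. \<forall>X'\<in>E. side_info F S C X = side_info F S C X' \<longrightarrow> X W = X' W)"

text \<open>\<open>M \<ge> 2\<close> gives \<open>k\<close> in \<open>S\<close> besides
  \<open>W\<close>. On \<open>E\<close> the side information determines the entry at
  \<open>W\<close>, and together with the entries off \<open>W\<close> and \<open>k\<close> it then
  yields the entry at \<open>k\<close>. So \<open>K - 1\<close> field elements determine a vector of
  \<open>E\<close>.\<close>

lemma card_determined_le_1:
  assumes M: "2 \<le> M" and E: "E \<subseteq> message_vectors K F"
    and S: "S \<in> support_sets K M" and W: "W \<in> S" and C: "C \<in> coeff_seqs M F B"
    and det: "determines E W S C"
  shows "card E * card (carrier F) \<le> card (message_vectors K F)"
proof -
  note Sd = support_setsD[OF S]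
  have "card (S - {W}) > 0" using Sd W M by simp
  then obtain k where k: "k \<in> S" "k \<noteq> W" by (metis DiffE card_gt_0_iff ex_in_conv insertI1)
  let ?I = "{1..K} - {W, k}"
  have J: "card {W, k} = 2" "{W, k} \<subseteq> {1..K}" using Sd W k by auto
  then have card_I: "card ?I = K - 2" and K: "2 \<le> K"
    using card_mono[of "{1..K}" "{W, k}"] card_Diff_subset[of "{W, k}" "{1..K}"] by simp_all
  let ?f = "\<lambda>X. (side_info F S C X, restrict X ?I)"
  let ?T = "carrier F \<times> (\<Pi>\<^sub>E i\<in>?I. carrier F)"
  have "inj_on ?f E"
  proof (rule inj_onI)
    fix X X' assume XX: "X \<in> E" "X' \<in> E" "?f X = ?f X'"
    then have Y: "side_info F S C X = side_info F S C X'" and r: "restrict X ?I = restrict X' ?I" by auto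
    have I: "X i = X' i" if "i \<in> ?I" for i using fun_cong[OF r, of i] that by simp
    have w: "X W = X' W" using det XX Y by (auto simp: determines_def)
    have msg: "X \<in> message_vectors K F" "X' \<in> message_vectors K F" using XX E by auto
    have k': "X k = X' k"
    proof (rule side_info_cancel[OF S C msg Y k(1)])
      fix i assume "i \<in> S" "i \<noteq> k"
      then have "i = W \<or> i \<in> ?I" using Sd(1) by blast
      then show "X i = X' i" by (elim disjE) (simp_all only: w I)
    qed
    show "X = X'"
    proof (rule PiE_ext[OF msg[unfolded message_vectors_def]])
      fix i assume "i \<in> {1..K}"
      then have "i = W \<or> i = k \<or> i \<in> ?I" by blast
      then show "X i = X' i" by (elim disjE) (simp_all only: w k' I)
    qed
  qed
  moreover have "?f ` E \<subseteq> ?T"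
  proof (rule image_subsetI)
    fix X assume "X \<in> E"
    then have "X \<in> message_vectors K F" using E by blast
    then show "?f X \<in> ?T"
      by (simp add: side_info_closed[OF S C] restrict_PiE_iff message_closed)
  qed
  moreover have "finite ?T" using finite_F by (auto intro!: finite_PiE)
  ultimately have "card E \<le> card ?T" by (rule card_inj_on_le)
  also have "\<dots> = card (carrier F) * card (carrier F) ^ card ?I"
    by (simp add: card_cartesian_product card_PiE)
  finally have "card E * card (carrier F) \<le> card (carrier F) ^ (K - 2) * (card (carrier F))\<^sup>2"
    unfolding card_I by (simp add: power2_eq_square mult_ac)
  also have "\<dots> = card (carrier F) ^ K" using K by (metis power_add le_add_diff_inverse2)
  finally show ?thesis by (simp add: card_message_vectors)
qed

text \<open>Two side informations and the entries off four positions, \<open>K - 2\<close> field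
  elements in all, determine a vector of \<open>E\<close>: first the entries at both demands, then
  at \<open>k\<close>, then at \<open>j\<close>.\<close>

lemma card_determined_le_2_aux:
  assumes E: "E \<subseteq> message_vectors K F"
    and S1: "S\<^sub>1 \<in> support_sets K M" and W1: "W\<^sub>1 \<in> S\<^sub>1" and C1: "C\<^sub>1 \<in> coeff_seqs M F B"
    and det1: "determines E W\<^sub>1 S\<^sub>1 C\<^sub>1"
    and S2: "S\<^sub>2 \<in> support_sets K M" and W2: "W\<^sub>2 \<in> S\<^sub>2" and C2: "C\<^sub>2 \<in> coeff_seqs M F B"
    and det2: "determines E W\<^sub>2 S\<^sub>2 C\<^sub>2"
    and ne: "W\<^sub>1 \<noteq> W\<^sub>2" and j: "j \<in> S\<^sub>1 - {W\<^sub>1, W\<^sub>2} - S\<^sub>2" and k: "k \<in> S\<^sub>2 - {W\<^sub>1, W\<^sub>2}"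
  shows "card E * (card (carrier F))\<^sup>2 \<le> card (message_vectors K F)"
proof -
  note Sd = support_setsD[OF S1] support_setsD[OF S2]
  let ?J = "{W\<^sub>1, W\<^sub>2, j, k}"
  let ?I = "{1..K} - ?J"
  have "j \<noteq> k" using j k by auto
  then have card_J: "card ?J = 4" using j k ne by (simp add: card_insert_if)
  have "?J \<subseteq> {1..K}" using Sd W1 W2 j k by auto
  with card_J have card_I: "card ?I = K - 4" and K: "4 \<le> K"
    using card_mono[of "{1..K}" ?J] card_Diff_subset[of ?J "{1..K}"] by simp_all
  let ?f = "\<lambda>X. (side_info F S\<^sub>1 C\<^sub>1 X, side_info F S\<^sub>2 C\<^sub>2 X, restrict X ?I)"
  let ?T = "carrier F \<times> carrier F \<times> (\<Pi>\<^sub>E i\<in>?I. carrier F)"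
  have "inj_on ?f E"
  proof (rule inj_onI)
    fix X X' assume XX: "X \<in> E" "X' \<in> E" "?f X = ?f X'"
    then have Y: "side_info F S\<^sub>1 C\<^sub>1 X = side_info F S\<^sub>1 C\<^sub>1 X'" "side_info F S\<^sub>2 C\<^sub>2 X = side_info F S\<^sub>2 C\<^sub>2 X'"
      and r: "restrict X ?I = restrict X' ?I" by auto
    have I: "X i = X' i" if "i \<in> ?I" for i using fun_cong[OF r, of i] that by simp
    have w: "X W\<^sub>1 = X' W\<^sub>1" "X W\<^sub>2 = X' W\<^sub>2"
      using det1 det2 XX Y by (auto simp: determines_def)
    have msg: "X \<in> message_vectors K F" "X' \<in> message_vectors K F" using XX E by auto
    \<comment> \<open>The entry at \<open>k\<close> comes first: \<open>S\<^sub>2\<close> avoids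
      \<open>j\<close>, whereas \<open>S\<^sub>1\<close> may contain \<open>k\<close>.\<close>
    have k': "X k = X' k"
    proof (rule side_info_cancel[OF S2 C2 msg Y(2)])
      show "k \<in> S\<^sub>2" using k by simp
      fix i assume "i \<in> S\<^sub>2" "i \<noteq> k"
      then have "i = W\<^sub>1 \<or> i = W\<^sub>2 \<or> i \<in> ?I" using Sd(4) j by blast
      then show "X i = X' i" by (elim disjE) (simp_all only: w I)
    qed
    have j': "X j = X' j"
    proof (rule side_info_cancel[OF S1 C1 msg Y(1)])
      show "j \<in> S\<^sub>1" using j by simp
      fix i assume "i \<in> S\<^sub>1" "i \<noteq> j"
      then have "i = W\<^sub>1 \<or> i = W\<^sub>2 \<or> i = k \<or> i \<in> ?I" using Sd(1) by blast
      then show "X i = X' i" by (elim disjE) (simp_all only: w k' I)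
    qed
    show "X = X'"
    proof (rule PiE_ext[OF msg[unfolded message_vectors_def]])
      fix i assume "i \<in> {1..K}"
      then have "i = W\<^sub>1 \<or> i = W\<^sub>2 \<or> i = j \<or> i = k \<or> i \<in> ?I" by blast
      then show "X i = X' i" by (elim disjE) (simp_all only: w k' j' I)
    qed
  qed
  moreover have "?f ` E \<subseteq> ?T"
  proof (rule image_subsetI)
    fix X assume "X \<in> E"
    then have "X \<in> message_vectors K F" using E by blast
    then show "?f X \<in> ?T"
      by (simp add: side_info_closed[OF S1 C1] side_info_closed[OF S2 C2] restrict_PiE_iff message_closed)
  qed
  moreover have "finite ?T" using finite_F by (auto intro!: finite_PiE)
  ultimately have "card E \<le> card ?T" by (rule card_inj_on_le)
  also have "\<dots> = (card (carrier F))\<^sup>2 * card (carrier F) ^ card ?I"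
    by (simp add: card_cartesian_product card_PiE power2_eq_square)
  finally have "card E * (card (carrier F))\<^sup>2 \<le> card (carrier F) ^ (K - 4) * card (carrier F) ^ 4"
    unfolding card_I by (simp add: power2_eq_square numeral_eq_Suc mult_ac)
  also have "\<dots> = card (carrier F) ^ K" using K by (simp flip: power_add)
  finally show ?thesis by (simp add: card_message_vectors)
qed

text \<open>Supports that differ off the demands give an index \<open>j\<close> in one but not in
  the other, up to exchanging the two; \<open>M \<ge> 3\<close> gives an index \<open>k\<close> of
  the other support besides the demands.\<close>

lemma card_determined_le_2:
  assumes M: "3 \<le> M" and E: "E \<subseteq> message_vectors K F"
    and S1: "S\<^sub>1 \<in> support_sets K M" and W1: "W\<^sub>1 \<in> S\<^sub>1" and C1: "C\<^sub>1 \<in> coeff_seqs M F B"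
    and det1: "determines E W\<^sub>1 S\<^sub>1 C\<^sub>1"
    and S2: "S\<^sub>2 \<in> support_sets K M" and W2: "W\<^sub>2 \<in> S\<^sub>2" and C2: "C\<^sub>2 \<in> coeff_seqs M F B"
    and det2: "determines E W\<^sub>2 S\<^sub>2 C\<^sub>2"
    and ne: "W\<^sub>1 \<noteq> W\<^sub>2" and T: "S\<^sub>1 - {W\<^sub>1, W\<^sub>2} \<noteq> S\<^sub>2 - {W\<^sub>1, W\<^sub>2}"
  shows "card E * (card (carrier F))\<^sup>2 \<le> card (message_vectors K F)"
proof -
  have nonempty: "S - {W\<^sub>1, W\<^sub>2} \<noteq> {}" if "S \<in> support_sets K M" for S
  proof
    assume "S - {W\<^sub>1, W\<^sub>2} = {}"
    then have "card S \<le> card {W\<^sub>1, W\<^sub>2}" by (intro card_mono) auto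
    then show False using support_setsD[OF that] M by (simp add: card_insert_if split: if_splits)
  qed
  have "\<exists>j. j \<in> S\<^sub>1 - {W\<^sub>1, W\<^sub>2} - S\<^sub>2 \<or> j \<in> S\<^sub>2 - {W\<^sub>2, W\<^sub>1} - S\<^sub>1" using T by blast
  then consider j where "j \<in> S\<^sub>1 - {W\<^sub>1, W\<^sub>2} - S\<^sub>2" | j where "j \<in> S\<^sub>2 - {W\<^sub>2, W\<^sub>1} - S\<^sub>1" by blast
  then show ?thesis
  proof cases
    case 1
    obtain k where "k \<in> S\<^sub>2 - {W\<^sub>1, W\<^sub>2}" using nonempty[OF S2] by auto
    from card_determined_le_2_aux[OF E S1 W1 C1 det1 S2 W2 C2 det2 ne 1 this] show ?thesis .
  next
    case 2
    obtain k where "k \<in> S\<^sub>1 - {W\<^sub>2, W\<^sub>1}" using nonempty[OF S1] by auto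
    from card_determined_le_2_aux[OF E S2 W2 C2 det2 S1 W1 C1 det1 ne[symmetric] 2 this] show ?thesis .
  qed
qed

text \<open>Otherwise the supports chosen for any two demands agree off these demands. For
  \<open>1\<close>, some \<open>W\<close> in \<open>S 1\<close> and some \<open>V\<close> outside
  \<open>S 1\<close>, this forces more than \<open>M\<close> elements into
  \<open>S V\<close>.\<close>

lemma card_determined_le:
  assumes M: "3 \<le> M" "M < K" and E: "E \<subseteq> message_vectors K F"
    and det: "\<And>W. W \<in> {1..K} \<Longrightarrow>
      \<exists>S C. S \<in> support_sets K M \<and> W \<in> S \<and> C \<in> coeff_seqs M F B \<and> determines E W S C"
  shows "card E * (card (carrier F))\<^sup>2 \<le> card (message_vectors K F)"
proof (rule ccontr)
  assume contr: "\<not> ?thesis"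
  obtain S C where S: "S W \<in> support_sets K M" "W \<in> S W" and C: "C W \<in> coeff_seqs M F B"
    and d: "determines E W (S W) (C W)" if "W \<in> {1..K}" for W
    using det by metis
  have eq: "S W - {W, W'} = S W' - {W, W'}" if "W \<in> {1..K}" "W' \<in> {1..K}" "W \<noteq> W'" for W W'
    using card_determined_le_2[OF M(1) E S[OF that(1)] C[OF that(1)] d[OF that(1)]
        S[OF that(2)] C[OF that(2)] d[OF that(2)] that(3)] contr by blast
  have one: "1 \<in> {1..K}" using M by auto
  note S1 = S[OF one] support_setsD[OF S(1)[OF one]]
  have "card (S 1 - {1}) > 0" using S1 M by simp
  then obtain W where W: "W \<in> S 1" "W \<noteq> 1" by (metis DiffE card_gt_0_iff ex_in_conv insertI1)
  have WK: "W \<in> {1..K}" using W S1 by auto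
  \<comment> \<open>This is where \<open>M < K\<close> enters.\<close>
  have "S 1 \<noteq> {1..K}" using S1 M by auto
  then obtain V where V: "V \<in> {1..K}" "V \<notin> S 1" using S1(3) by blast
  note SW = S[OF WK] support_setsD[OF S(1)[OF WK]]
  note SV = S[OF V(1)] support_setsD[OF S(1)[OF V(1)]]
  have V1: "V \<noteq> 1" "V \<noteq> W" using V W S1 by auto
  have "S 1 - {1, W} = S W - {1, W}" using eq[OF one WK] W by auto
  moreover have "card (S 1 - {1, W}) = M - 2" using S1 W by (subst card_Diff_subset) auto
  ultimately have "card (S W - {1, W}) = M - 2" by simp
  \<comment> \<open>Otherwise only \<open>W\<close> would be removed from \<open>S W\<close>,
    leaving \<open>M - 1\<close> elements instead of \<open>M - 2\<close>.\<close>
  have "1 \<in> S W"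
  proof (rule ccontr)
    assume "1 \<notin> S W"
    then have "S W - {1, W} = S W - {W}" by auto
    then show False using \<open>card (S W - {1, W}) = M - 2\<close> SW M by simp
  qed
  moreover have "S W - {W, V} = S V - {W, V}" using eq[OF WK V(1)] V1 by auto
  ultimately have "1 \<in> S V" using W V1 by auto
  \<comment> \<open>As \<open>V\<close> is not in \<open>S 1\<close>, only \<open>1\<close> is
    removed on the left. So \<open>S V\<close> has \<open>M - 1\<close> elements besides
    \<open>1\<close> and \<open>V\<close>, and it contains both of these.\<close>
  have "S 1 - {1} = S V - {1, V}" using eq[OF one V(1)] V V1 by auto
  moreover have "card (S 1 - {1}) = M - 1" using S1 by simp
  ultimately have "card (S V - {1, V}) = M - 1" by simp
  then show False using \<open>1 \<in> S V\<close> SV V1 M by (simp add: card_Diff_subset)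
qed

end

section \<open>The joint distribution and the converse\<close>

lemma finite_support_sets: "finite (support_sets K M)"
  by (rule finite_subset[of _ "Pow {1..K}"]) (auto simp: support_sets_def)

lemma support_sets_nonempty: "M \<le> K \<Longrightarrow> support_sets K M \<noteq> {}"
  using obtain_subset_with_card_n[of M "{1..K}"] by (force simp: support_sets_def)

context pir_field
begin

lemma finite_coeff_seqs: "finite (coeff_seqs M F B)"
proof -
  have "coeff_seqs M F B = {C. set C \<subseteq> B - {\<zero>} \<and> length C = M}"
    by (auto simp: coeff_seqs_def)
  moreover have "finite (B - {\<zero>})" using B_subset finite_F finite_subset by blast
  ultimately show ?thesis by (simp add: finite_lists_length_eq)
qed

lemma coeff_seqs_nonempty: "coeff_seqs M F B \<noteq> {}"
proof -
  have "replicate M \<one> \<in> coeff_seqs M F B" using one_B by (auto simp: coeff_seqs_def)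
  then show ?thesis by blast
qed

lemma set_joint_pmf:
  assumes "1 \<le> M" "M \<le> K"
  shows "set_pmf (joint_pmf K M F B P) =
    {\<lparr>demand = W, supp_set = S, coeff_seq = C, query = Q, messages = X\<rparr> | W S C Q X.
      S \<in> support_sets K M \<and> W \<in> S \<and> C \<in> coeff_seqs M F B \<and> Q \<in> set_pmf (query_kernel P W S C)
      \<and> X \<in> message_vectors K F}"
proof -
  have S: "S \<noteq> {}" "finite S" if "S \<in> support_sets K M" for S
    using support_setsD[OF that] assms(1) by auto
  have set_S: "set_pmf (pmf_of_set S) = S" if "S \<in> support_sets K M" for S
    using S[OF that] by simp
  show ?thesis
    unfolding joint_pmf_def
    using set_S
    by (force simp: finite_support_sets support_sets_nonempty[OF assms(2)] finite_coeff_seqs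
        coeff_seqs_nonempty finite_message_vectors message_vectors_nonempty)
qed

text \<open>The demand always lies in the support, so the conditioning event has probability one and
  the denominator of the rate is an unconditional entropy.\<close>

lemma cond_pmf_joint:
  assumes "1 \<le> M" "M \<le> K"
  shows "cond_pmf (joint_pmf K M F B P) {\<omega>. demand_in_support \<omega>} = joint_pmf K M F B P"
proof -
  let ?p = "joint_pmf K M F B P" and ?A = "{\<omega>. demand_in_support \<omega>}"
  have sub: "set_pmf ?p \<subseteq> ?A"
    by (auto simp: set_joint_pmf[OF assms] demand_in_support_def)
  then have ne: "set_pmf ?p \<inter> ?A \<noteq> {}" using set_pmf_not_empty[of ?p] by auto
  have m: "measure ?p ?A = 1"
    using sub by (subst measure_pmf.prob_eq_1) (auto simp: AE_measure_pmf_iff)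
  show ?thesis
  proof (rule pmf_eqI)
    fix x
    show "pmf (cond_pmf ?p ?A) x = pmf ?p x"
      using sub unfolding pmf_cond[OF ne] m by (auto simp: set_pmf_iff)
  qed
qed

lemma joint_pmf_bind:
  "joint_pmf K M F B P = do {
     S \<leftarrow> pmf_of_set (support_sets K M);
     W \<leftarrow> pmf_of_set S;
     C \<leftarrow> pmf_of_set (coeff_seqs M F B);
     Q \<leftarrow> query_kernel P W S C;
     map_pmf (\<lambda>X. \<lparr>demand = W, supp_set = S, coeff_seq = C, query = Q, messages = X\<rparr>)
       (pmf_of_set (message_vectors K F))
   }"
  by (simp add: joint_pmf_def map_pmf_def)

lemma pmf_bind_le:
  assumes "\<And>x. x \<in> set_pmf p \<Longrightarrow> pmf (f x) a \<le> c"
  shows "pmf (bind_pmf p f) a \<le> c"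
proof -
  have "pmf (bind_pmf p f) a = (\<integral>x. pmf (f x) a \<partial>measure_pmf p)" by (rule pmf_bind)
  also have "\<dots> \<le> c"
    by (intro measure_pmf.integral_le_const)
      (auto simp: AE_measure_pmf_iff assms pmf_le_1 intro!: measure_pmf.integrable_const_bound[where B=1])
  finally show ?thesis .
qed

text \<open>Given demand, support, coefficients and query, the messages are still uniform, so an
  answer has the probability of its fibre among all message vectors. Averaging over the other
  variables preserves the bound.\<close>

lemma pmf_answer_le:
  fixes N :: nat
  assumes M: "1 \<le> M" "M \<le> K" and N: "0 < N"
    and le: "\<And>Q a. Q \<in> set_pmf (map_pmf query (joint_pmf K M F B P)) \<Longrightarrow>
      card {X \<in> message_vectors K F. answer_map P Q True X = a} * N \<le> card (message_vectors K F)"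
  shows "pmf (map_pmf (answer P) (joint_pmf K M F B P)) a \<le> 1 / N"
  unfolding joint_pmf_bind map_bind_pmf
proof (intro pmf_bind_le)
  fix S W C Q
  assume S: "S \<in> set_pmf (pmf_of_set (support_sets K M))" and W: "W \<in> set_pmf (pmf_of_set S)"
    and C: "C \<in> set_pmf (pmf_of_set (coeff_seqs M F B))" and Q: "Q \<in> set_pmf (query_kernel P W S C)"
  have S: "S \<in> support_sets K M"
    using S by (simp add: finite_support_sets support_sets_nonempty[OF M(2)])
  then have W: "W \<in> S" using W support_setsD[OF S] M by (subst (asm) set_pmf_of_set) auto
  have C: "C \<in> coeff_seqs M F B" using C by (simp add: finite_coeff_seqs coeff_seqs_nonempty)
  obtain X where "X \<in> message_vectors K F" using message_vectors_nonempty by blast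
  then have "\<lparr>demand = W, supp_set = S, coeff_seq = C, query = Q, messages = X\<rparr> \<in> set_pmf (joint_pmf K M F B P)"
    using S W C Q by (simp add: set_joint_pmf[OF M])
  then have Qs: "Q \<in> set_pmf (map_pmf query (joint_pmf K M F B P))"
    by (auto simp: image_iff intro!: bexI)
  let ?V = "message_vectors K F" and ?E = "{X \<in> message_vectors K F. answer_map P Q True X = a}"
  have "pmf (map_pmf (answer P) (map_pmf (\<lambda>X. \<lparr>demand = W, supp_set = S, coeff_seq = C, query = Q, messages = X\<rparr>) (pmf_of_set ?V))) a
    = measure (pmf_of_set ?V) {X. answer_map P Q True X = a}"
    using W by (simp add: pmf.map_comp pmf_map vimage_def answer_def demand_in_support_def)
  also have "\<dots> = card ?E / card ?V"
    by (subst measure_pmf_of_set[OF message_vectors_nonempty finite_message_vectors])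
      (simp add: Int_def conj_commute)
  also have "\<dots> \<le> 1 / N"
  proof -
    have "card ?V > 0" by (simp add: card_gt_0_iff finite_message_vectors message_vectors_nonempty)
    moreover have "real (card ?E) * real N \<le> real (card ?V)"
      using le[OF Qs, of a] by (simp flip: of_nat_mult)
    ultimately show ?thesis using N by (simp add: field_simps)
  qed
  finally show "pmf (map_pmf (answer P) (map_pmf (\<lambda>X. \<lparr>demand = W, supp_set = S, coeff_seq = C, query = Q, messages = X\<rparr>) (pmf_of_set ?V))) a \<le> 1 / N" .
qed

lemma finite_demand: "\<lbrakk>1 \<le> M; M \<le> K\<rbrakk> \<Longrightarrow> finite (demand ` set_pmf (joint_pmf K M F B P))"
  by (rule finite_subset[of _ "{1..K}"]) (auto simp: set_joint_pmf dest!: support_setsD(1))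

text \<open>Zero conditional entropy means functional dependence on the outcomes that can occur. All
  message vectors can occur with every possible query, so the condition splits into one for each
  fibre of the answer map.\<close>

lemma recoverability_iff:
  assumes M: "1 \<le> M" "M \<le> K"
  shows "recoverability K M F B P \<longleftrightarrow>
    (\<forall>S\<in>support_sets K M. \<forall>W\<in>S. \<forall>C\<in>coeff_seqs M F B. \<forall>Q\<in>set_pmf (query_kernel P W S C). \<forall>a.
      determines {X \<in> message_vectors K F. answer_map P Q True X = a} W S C)"
proof -
  have "finite (demanded_message ` set_pmf (joint_pmf K M F B P))"
  proof (rule finite_subset[OF _ finite_F], rule image_subsetI)
    fix \<omega> assume "\<omega> \<in> set_pmf (joint_pmf K M F B P)"
    then obtain W S X where "S \<in> support_sets K M" "W \<in> S" "X \<in> message_vectors K F"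
      and "demanded_message \<omega> = X W"
      by (auto simp: set_joint_pmf[OF M] demanded_message_def)
    then show "demanded_message \<omega> \<in> carrier F"
      using support_setsD(1)[of S K M] by (auto intro!: message_closed[of X K W])
  qed
  then have iff: "recoverability K M F B P \<longleftrightarrow>
      (\<forall>\<omega>\<in>set_pmf (joint_pmf K M F B P). \<forall>\<omega>'\<in>set_pmf (joint_pmf K M F B P).
        (answer P \<omega>, query \<omega>, demand_in_support \<omega>, side_information F \<omega>, demand \<omega>, supp_set \<omega>, coeff_seq \<omega>)
        = (answer P \<omega>', query \<omega>', demand_in_support \<omega>', side_information F \<omega>', demand \<omega>', supp_set \<omega>', coeff_seq \<omega>')
        \<longrightarrow> demanded_message \<omega> = demanded_message \<omega>')"
    unfolding recoverability_def by (rule cond_shannon_entropy_eq_0_iff)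
  show ?thesis
  proof
    assume rec: "recoverability K M F B P"
    show "\<forall>S\<in>support_sets K M. \<forall>W\<in>S. \<forall>C\<in>coeff_seqs M F B. \<forall>Q\<in>set_pmf (query_kernel P W S C). \<forall>a.
      determines {X \<in> message_vectors K F. answer_map P Q True X = a} W S C"
      unfolding determines_def
    proof (intro ballI allI impI)
      fix S W C Q a X X'
      assume *: "S \<in> support_sets K M" "W \<in> S" "C \<in> coeff_seqs M F B" "Q \<in> set_pmf (query_kernel P W S C)"
        "X \<in> {X \<in> message_vectors K F. answer_map P Q True X = a}"
        "X' \<in> {X \<in> message_vectors K F. answer_map P Q True X = a}"
        "side_info F S C X = side_info F S C X'"
      let ?o = "\<lambda>X. \<lparr>demand = W, supp_set = S, coeff_seq = C, query = Q, messages = X\<rparr>"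
      have "?o X \<in> set_pmf (joint_pmf K M F B P)" "?o X' \<in> set_pmf (joint_pmf K M F B P)"
        using * by (simp_all add: set_joint_pmf[OF M])
      from rec[unfolded iff, rule_format, OF this] * show "X W = X' W"
        by (simp add: answer_def demand_in_support_def side_information_def demanded_message_def)
    qed
  next
    assume det: "\<forall>S\<in>support_sets K M. \<forall>W\<in>S. \<forall>C\<in>coeff_seqs M F B. \<forall>Q\<in>set_pmf (query_kernel P W S C). \<forall>a.
      determines {X \<in> message_vectors K F. answer_map P Q True X = a} W S C"
    show "recoverability K M F B P"
      unfolding iff
    proof (intro ballI impI)
      fix \<omega> \<omega>'
      assume \<omega>: "\<omega> \<in> set_pmf (joint_pmf K M F B P)" and \<omega>': "\<omega>' \<in> set_pmf (joint_pmf K M F B P)"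
        and eq: "(answer P \<omega>, query \<omega>, demand_in_support \<omega>, side_information F \<omega>, demand \<omega>, supp_set \<omega>, coeff_seq \<omega>)
        = (answer P \<omega>', query \<omega>', demand_in_support \<omega>', side_information F \<omega>', demand \<omega>', supp_set \<omega>', coeff_seq \<omega>')"
      obtain W S C Q X where *: "\<omega> = \<lparr>demand = W, supp_set = S, coeff_seq = C, query = Q, messages = X\<rparr>"
        "S \<in> support_sets K M" "W \<in> S" "C \<in> coeff_seqs M F B" "Q \<in> set_pmf (query_kernel P W S C)"
        "X \<in> message_vectors K F"
        using \<omega> unfolding set_joint_pmf[OF M] by blast
      obtain X' where X': "\<omega>' = \<lparr>demand = W, supp_set = S, coeff_seq = C, query = Q, messages = X'\<rparr>"
        "X' \<in> message_vectors K F"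
        using \<omega>' eq *(1) unfolding set_joint_pmf[OF M] by force
      have "determines {X'' \<in> message_vectors K F. answer_map P Q True X'' = answer_map P Q True X} W S C"
        using det *(2-5) by blast
      moreover have "answer_map P Q True X' = answer_map P Q True X" "side_info F S C X = side_info F S C X'"
        using eq *(3) by (simp_all add: *(1) X'(1) answer_def demand_in_support_def side_information_def)
      ultimately show "demanded_message \<omega> = demanded_message \<omega>'"
        using *(6) X'(2) by (simp add: determines_def *(1) X'(1) demanded_message_def)
    qed
  qed
qed

lemma W_privacy_iff:
  assumes M: "1 \<le> M" "M \<le> K"
  shows "W_privacy K M F B P \<longleftrightarrow>
    (\<forall>W Q. pmf (map_pmf (\<lambda>\<omega>. (demand \<omega>, query \<omega>)) (joint_pmf K M F B P)) (W, Q) =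
      pmf (map_pmf demand (joint_pmf K M F B P)) W * pmf (map_pmf query (joint_pmf K M F B P)) Q)"
  unfolding W_privacy_def
  by (rule cond_mutual_info_eq_0_iff[where z = True])
    (auto simp: finite_demand[OF M], auto simp: set_joint_pmf[OF M] demand_in_support_def)

text \<open>Every demand has positive probability, so by independence it occurs jointly with every
  query that occurs at all. The support and coefficients may vary with \<open>W\<close>.\<close>

lemma query_possible_for_all_demands:
  assumes M: "1 \<le> M" "M \<le> K" and priv: "W_privacy K M F B P"
    and Q: "Q \<in> set_pmf (map_pmf query (joint_pmf K M F B P))" and W: "W \<in> {1..K}"
  shows "\<exists>S C. S \<in> support_sets K M \<and> W \<in> S \<and> C \<in> coeff_seqs M F B \<and> Q \<in> set_pmf (query_kernel P W S C)"
proof -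
  \<comment> \<open>Some support contains \<open>W\<close>, which shows that \<open>W\<close> is a
    possible demand.\<close>
  obtain S0 where S0: "S0 \<subseteq> {1..K} - {W}" "card S0 = M - 1"
  proof (rule obtain_subset_with_card_n[of "M - 1" "{1..K} - {W}"])
    show "M - 1 \<le> card ({1..K} - {W})" using W M by simp
  qed blast
  have "finite S0" using S0 finite_subset by blast
  then have "card (insert W S0) = M" using S0 M by (subst card_insert_disjoint) auto
  then have S: "insert W S0 \<in> support_sets K M" using S0 W by (auto simp: support_sets_def)
  obtain C where C: "C \<in> coeff_seqs M F B" using coeff_seqs_nonempty by blast
  obtain X where X: "X \<in> message_vectors K F" using message_vectors_nonempty by blast
  obtain Q' where "Q' \<in> set_pmf (query_kernel P W (insert W S0) C)" using set_pmf_not_empty by fastforce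
  with S C X have "\<lparr>demand = W, supp_set = insert W S0, coeff_seq = C, query = Q', messages = X\<rparr>
      \<in> set_pmf (joint_pmf K M F B P)"
    by (simp add: set_joint_pmf[OF M])
  then have "W \<in> set_pmf (map_pmf demand (joint_pmf K M F B P))"
    by (auto simp: image_iff intro!: bexI)
  then have "pmf (map_pmf demand (joint_pmf K M F B P)) W * pmf (map_pmf query (joint_pmf K M F B P)) Q \<noteq> 0"
    using Q by (simp only: set_pmf_iff) simp
  then have "(W, Q) \<in> set_pmf (map_pmf (\<lambda>\<omega>. (demand \<omega>, query \<omega>)) (joint_pmf K M F B P))"
    using priv[unfolded W_privacy_iff[OF M], rule_format, of W Q] by (simp only: set_pmf_iff) simp
  then show ?thesis by (auto simp: set_joint_pmf[OF M]) blast
qed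

lemma card_answer_le:
  assumes M: "2 \<le> M" "M \<le> K" and P: "PIR_CSI_II K M F B P"
    and Q: "Q \<in> set_pmf (map_pmf query (joint_pmf K M F B P))"
    and n: "n = (if 3 \<le> M \<and> M < K then 2 else 1)"
  shows "card {X \<in> message_vectors K F. answer_map P Q True X = a} * card (carrier F) ^ n
    \<le> card (message_vectors K F)"
proof -
  have M': "1 \<le> M" using M by simp
  let ?E = "{X \<in> message_vectors K F. answer_map P Q True X = a}"
  have E: "?E \<subseteq> message_vectors K F" by auto
  have *: "\<exists>S C. S \<in> support_sets K M \<and> W \<in> S \<and> C \<in> coeff_seqs M F B \<and> determines ?E W S C"
    if W: "W \<in> {1..K}" for W
    using query_possible_for_all_demands[OF M' M(2) _ Q W] P[unfolded PIR_CSI_II_def recoverability_iff[OF M' M(2)]]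
    by blast
  show ?thesis
  proof (cases "3 \<le> M \<and> M < K")
    case True
    then show ?thesis using card_determined_le[OF _ _ E *] n by simp
  next
    case False
    \<comment> \<open>A single demand suffices for one dimension; \<open>1\<close> is as good as
      any.\<close>
    have "1 \<in> {1..K}" using M by simp
    from *[OF this] obtain S C where "S \<in> support_sets K M" "1 \<in> S" "C \<in> coeff_seqs M F B" "determines ?E 1 S C"
      by blast
    from card_determined_le_1[OF M(1) E this] show ?thesis using False n by auto
  qed
qed

section \<open>From fibre sizes to bounds on the rate\<close>

definition msg_entropy :: real where "msg_entropy = real l * log 2 (real q)"

lemma msg_entropy_pos: "0 < msg_entropy"
  unfolding msg_entropy_def using q_gt_1 l_ge by (intro mult_pos_pos) auto

lemma log_card_F_power: "log 2 (real (card (carrier F) ^ n)) = real n * msg_entropy"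
  using q_gt_1 by (simp add: card_F msg_entropy_def log_nat_power flip: power_mult)

text \<open>The first form leaves room for an infinite entropy, read as \<open>0\<close>. The second
  excludes it for finitely many answers and later supplies a positive denominator for the
  rate.\<close>

lemma answer_entropy_cases:
  assumes M: "2 \<le> M" "M \<le> K" and P: "PIR_CSI_II K M F B P"
    and n: "n = (if 3 \<le> M \<and> M < K then 2 else 1)"
  shows "shannon_entropy (joint_pmf K M F B P) (answer P) = 0 \<or>
    real n * msg_entropy \<le> shannon_entropy (joint_pmf K M F B P) (answer P)"
    "finite R \<Longrightarrow> answer P ` set_pmf (joint_pmf K M F B P) \<subseteq> R \<Longrightarrow>
    real n * msg_entropy \<le> shannon_entropy (joint_pmf K M F B P) (answer P)"
proof -
  have M': "1 \<le> M" using M by simp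
  have N: "0 < card (carrier F) ^ n" using card_F_gt_1 by simp
  have le: "pmf (map_pmf (answer P) (joint_pmf K M F B P)) a \<le> 1 / (card (carrier F) ^ n)" for a
    by (rule pmf_answer_le[OF M' M(2) N card_answer_le[OF M P _ n]])
  have N': "0 < real (card (carrier F) ^ n)" using N by linarith
  show "shannon_entropy (joint_pmf K M F B P) (answer P) = 0 \<or>
    real n * msg_entropy \<le> shannon_entropy (joint_pmf K M F B P) (answer P)"
    using shannon_entropy_min_entropy_cases[OF N' le] unfolding log_card_F_power .
  show "real n * msg_entropy \<le> shannon_entropy (joint_pmf K M F B P) (answer P)"
    if R: "finite R" "answer P ` set_pmf (joint_pmf K M F B P) \<subseteq> R"
  proof -
    have "finite (answer P ` set_pmf (joint_pmf K M F B P))" using R finite_subset by blast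
    then show ?thesis
      using shannon_entropy_ge_min_entropy[OF N' le] unfolding log_card_F_power
      by (simp add: integrable_count_space)
  qed
qed

lemma rate_eq:
  assumes "1 \<le> M" "M \<le> K"
  shows "rate K M q l F B P = msg_entropy / shannon_entropy (joint_pmf K M F B P) (answer P)"
  by (simp add: rate_def msg_entropy_def cond_pmf_joint[OF assms])

text \<open>An infinite answer entropy appears as \<open>0\<close> and makes the rate
  \<open>0\<close> by division by zero, so the bound holds in that case too.\<close>

lemma rate_le:
  assumes M: "2 \<le> M" "M \<le> K" and P: "PIR_CSI_II K M F B P"
    and n: "n = (if 3 \<le> M \<and> M < K then 2 else 1)"
  shows "rate K M q l F B P \<le> 1 / real n"
  using answer_entropy_cases(1)[OF M P n] msg_entropy_pos M n
  by (auto simp: rate_eq field_simps split: if_splits)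

lemma rate_ge:
  assumes M: "2 \<le> M" "M \<le> K" and P: "PIR_CSI_II K M F B P"
    and R: "finite R" "answer P ` set_pmf (joint_pmf K M F B P) \<subseteq> R" "card R \<le> card (carrier F) ^ m"
    and m: "0 < m"
  shows "1 / real m \<le> rate K M q l F B P"
proof -
  let ?H = "shannon_entropy (joint_pmf K M F B P) (answer P)"
  define n :: nat where "n = (if 3 \<le> M \<and> M < K then 2 else 1)"
  have "0 < real n * msg_entropy" using msg_entropy_pos by (simp add: n_def)
  \<comment> \<open>The converse guarantees a positive entropy, without which an upper bound on it
    would not bound the rate from below.\<close>
  then have H: "0 < ?H" using answer_entropy_cases(2)[OF M P n_def R(1,2)] by linarith
  have "R \<noteq> {}" using R(2) set_pmf_not_empty by fastforce
  then have "card R > 0" using R by (simp add: card_gt_0_iff)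
  have "?H \<le> log 2 (card R)" by (rule shannon_entropy_le_card[OF R(1,2)])
  also have "\<dots> \<le> log 2 (real (card (carrier F) ^ m))"
    using \<open>card R > 0\<close> R(3) card_F_gt_1 by (subst log_le_cancel_iff) (auto simp flip: of_nat_power)
  finally have "?H \<le> real m * msg_entropy" unfolding log_card_F_power .
  then show ?thesis using H m M by (simp add: rate_eq field_simps)
qed

end

section \<open>Protocols\<close>

text \<open>All fibres have the same size, so every pair receives the same weight.\<close>

lemma bind_pmf_of_set_Sigma:
  fixes B :: "'a \<Rightarrow> 'b set"
  assumes A: "finite A" "A \<noteq> {}" and B: "\<And>x. x \<in> A \<Longrightarrow> finite (B x) \<and> card (B x) = n" and n: "0 < n"
  shows "pmf_of_set A \<bind> (\<lambda>x. map_pmf (Pair x) (pmf_of_set (B x))) = pmf_of_set (Sigma A B)"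
proof (rule pmf_eqI)
  fix z :: "'a \<times> 'b"
  obtain x y where z: "z = (x, y)" by (cases z)
  have B': "B x \<noteq> {}" "finite (B x)" if "x \<in> A" for x using B[OF that] n by auto
  have ne: "Sigma A B \<noteq> {}" "finite (Sigma A B)" using A B' by auto
  have card: "card (Sigma A B) = card A * n" using A B by simp
  have "pmf (map_pmf (Pair x') p) (x, y) = (if x' = x then pmf p y else 0)" for x' and p :: "'b pmf"
    by (auto simp: pmf_map vimage_def pmf.rep_eq)
  then have "pmf (pmf_of_set A \<bind> (\<lambda>x. map_pmf (Pair x) (pmf_of_set (B x)))) z
      = (if x \<in> A then pmf (pmf_of_set (B x)) y else 0) / card A"
    using A by (simp add: pmf_bind_pmf_of_set z sum.delta)
  also have "\<dots> = pmf (pmf_of_set (Sigma A B)) z"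
    using B[of x] B'[of x] ne n by (auto simp: z card indicator_def)
  finally show "pmf (pmf_of_set A \<bind> (\<lambda>x. map_pmf (Pair x) (pmf_of_set (B x)))) z = pmf (pmf_of_set (Sigma A B)) z" .
qed

text \<open>Both orders draw a uniform incident pair. It lets the demand be drawn before the support
  that contains it.\<close>

lemma bind_pmf_of_set_swap:
  assumes A: "finite A" "A \<noteq> {}" and A': "finite A'" "A' \<noteq> {}"
    and B: "\<And>x. x \<in> A \<Longrightarrow> finite (B x) \<and> card (B x) = n" and n: "0 < n"
    and B': "\<And>y. y \<in> A' \<Longrightarrow> finite (B' y) \<and> card (B' y) = n'" and n': "0 < n'"
    and rel: "\<And>x y. x \<in> A \<and> y \<in> B x \<longleftrightarrow> y \<in> A' \<and> x \<in> B' y"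
  shows "pmf_of_set A \<bind> (\<lambda>x. pmf_of_set (B x) \<bind> f x) = pmf_of_set A' \<bind> (\<lambda>y. pmf_of_set (B' y) \<bind> (\<lambda>x. f x y))"
proof -
  have Sigma_ne: "finite (Sigma A B)" "Sigma A B \<noteq> {}"
    if "finite A" "A \<noteq> {}" "\<And>x. x \<in> A \<Longrightarrow> finite (B x) \<and> card (B x) = n" "0 < n"
    for A :: "'x set" and B :: "'x \<Rightarrow> 'y set" and n
  proof -
    show "finite (Sigma A B)" using that by (intro finite_SigmaI) auto
    have "card (Sigma A B) = card A * n" using that by simp
    then show "Sigma A B \<noteq> {}" using that by (metis card.empty card_gt_0_iff mult_is_0 not_less0)
  qed
  have "pmf_of_set A \<bind> (\<lambda>x. pmf_of_set (B x) \<bind> f x) = pmf_of_set (Sigma A B) \<bind> (\<lambda>(x, y). f x y)"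
    by (simp only: bind_pmf_of_set_Sigma[of A B n, OF A B n, symmetric] bind_assoc_pmf bind_map_pmf prod.case)
  also have "pmf_of_set (Sigma A B) = map_pmf prod.swap (pmf_of_set (Sigma A' B'))"
  proof -
    have "bij_betw prod.swap (Sigma A' B') (Sigma A B)"
    proof (rule bij_betw_byWitness[where f' = prod.swap])
      have "prod.swap z \<in> Sigma A B" if "z \<in> Sigma A' B'" for z
        using that rel[of "snd z" "fst z"] by (cases z) simp
      then show "prod.swap ` Sigma A' B' \<subseteq> Sigma A B" by blast
      have "prod.swap z \<in> Sigma A' B'" if "z \<in> Sigma A B" for z
        using that rel[of "fst z" "snd z"] by (cases z) simp
      then show "prod.swap ` Sigma A B \<subseteq> Sigma A' B'" by blast
    qed simp_all
    then show ?thesis using Sigma_ne[OF A' B' n'] by (simp add: map_pmf_of_set_bij_betw)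
  qed
  also have "\<dots> \<bind> (\<lambda>(x, y). f x y) = pmf_of_set A' \<bind> (\<lambda>y. pmf_of_set (B' y) \<bind> (\<lambda>x. f x y))"
    by (simp only: bind_pmf_of_set_Sigma[of A' B' n', OF A' B' n', symmetric] bind_assoc_pmf bind_map_pmf
      prod.case prod.swap_def fst_conv snd_conv)
  finally show ?thesis .
qed

text \<open>The count does not depend on \<open>W\<close>, as exchanging demand and support
  requires.\<close>

lemma card_support_sets_containing:
  assumes "W \<in> {1..K}" "1 \<le> M"
  shows "card {S \<in> support_sets K M. W \<in> S} = (K - 1) choose (M - 1)"
proof -
  have "bij_betw (insert W) {S. S \<subseteq> {1..K} - {W} \<and> card S = M - 1} {S \<in> support_sets K M. W \<in> S}"
  proof (rule bij_betw_byWitness[where f' = "\<lambda>S. S - {W}"])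
    show "insert W ` {S. S \<subseteq> {1..K} - {W} \<and> card S = M - 1} \<subseteq> {S \<in> support_sets K M. W \<in> S}"
    proof (rule image_subsetI)
      fix S assume "S \<in> {S. S \<subseteq> {1..K} - {W} \<and> card S = M - 1}"
      then have S: "S \<subseteq> {1..K} - {W}" "card S = M - 1" by auto
      then have "finite S" by (meson finite_Diff finite_atLeastAtMost finite_subset)
      then have "card (insert W S) = M" using S assms by (subst card_insert_disjoint) auto
      then show "insert W S \<in> {S \<in> support_sets K M. W \<in> S}"
        using S assms by (auto simp: support_sets_def)
    qed
    show "(\<lambda>S. S - {W}) ` {S \<in> support_sets K M. W \<in> S} \<subseteq> {S. S \<subseteq> {1..K} - {W} \<and> card S = M - 1}"
      by (auto simp: support_sets_def)
  qed auto
  then have "card {S \<in> support_sets K M. W \<in> S} = card {S. S \<subseteq> {1..K} - {W} \<and> card S = M - 1}"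
    by (simp add: bij_betw_same_card)
  also have "\<dots> = (K - 1) choose (M - 1)"
    using assms by (subst n_subsets) auto
  finally show ?thesis .
qed

context pir_field
begin

section \<open>Coefficient vectors of weight \<open>M\<close> and their transfer\<close>

definition vecs :: "nat \<Rightarrow> nat \<Rightarrow> (nat \<Rightarrow> nat) set" where
  "vecs K M = {v. (\<forall>i. v i \<in> B) \<and> {i. v i \<noteq> \<zero>} \<in> support_sets K M}"

text \<open>The nonzero positions and the values there in increasing order recover the pair; a
  vector vanishes outside \<open>{1..K}\<close> because its support is a member of
  \<open>support_sets K M\<close>.\<close>

lemma bij_coeff_vec:
  "bij_betw (\<lambda>(S, C). coeff_vec S C) (support_sets K M \<times> coeff_seqs M F B) (vecs K M)"
proof (rule bij_betw_byWitness[where f' = "\<lambda>v. ({i. v i \<noteq> \<zero>}, map v (sorted_list_of_set {i. v i \<noteq> \<zero>}))"])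
  show "\<forall>a\<in>support_sets K M \<times> coeff_seqs M F B.
      (\<lambda>v. ({i. v i \<noteq> \<zero>}, map v (sorted_list_of_set {i. v i \<noteq> \<zero>}))) ((\<lambda>(S, C). coeff_vec S C) a) = a"
  proof
    fix a assume "a \<in> support_sets K M \<times> coeff_seqs M F B"
    then obtain S C where a: "a = (S, C)" and S: "S \<in> support_sets K M" and C: "C \<in> coeff_seqs M F B"
      by blast
    note Sd = support_setsD[OF S]
    have "{i. coeff_vec S C i \<noteq> \<zero>} = S" using coeff_vec_in(3)[OF S C] by auto
    moreover have "map (coeff_vec S C) (sorted_list_of_set S) = C"
      using C Sd by (intro nth_equalityI) (auto simp: coeff_seqs_def coeff_vec_nth)
    ultimately show "(\<lambda>v. ({i. v i \<noteq> \<zero>}, map v (sorted_list_of_set {i. v i \<noteq> \<zero>}))) ((\<lambda>(S, C). coeff_vec S C) a) = a"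
      by (simp add: a)
  qed
  show "\<forall>v\<in>vecs K M. (\<lambda>(S, C). coeff_vec S C) ({i. v i \<noteq> \<zero>}, map v (sorted_list_of_set {i. v i \<noteq> \<zero>})) = v"
  proof
    fix v assume v: "v \<in> vecs K M"
    then have "finite {i. v i \<noteq> \<zero>}" using support_setsD(3) by (auto simp: vecs_def)
    then show "(\<lambda>(S, C). coeff_vec S C) ({i. v i \<noteq> \<zero>}, map v (sorted_list_of_set {i. v i \<noteq> \<zero>})) = v"
      by (auto simp: coeff_vec_def fun_eq_iff map_of_zip_map)
  qed
  show "(\<lambda>(S, C). coeff_vec S C) ` (support_sets K M \<times> coeff_seqs M F B) \<subseteq> vecs K M"
    using coeff_vec_in(2,3) by (auto simp: vecs_def)
  show "(\<lambda>v. ({i. v i \<noteq> \<zero>}, map v (sorted_list_of_set {i. v i \<noteq> \<zero>}))) ` vecs K M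
      \<subseteq> support_sets K M \<times> coeff_seqs M F B"
    using support_setsD by (auto simp: vecs_def coeff_seqs_def)
qed

lemma bij_coeff_vec_containing:
  "bij_betw (\<lambda>(S, C). coeff_vec S C) ({S \<in> support_sets K M. W \<in> S} \<times> coeff_seqs M F B) {v \<in> vecs K M. v W \<noteq> \<zero>}"
proof -
  have "(\<lambda>(S, C). coeff_vec S C) ` ({S \<in> support_sets K M. W \<in> S} \<times> coeff_seqs M F B) = {v \<in> vecs K M. v W \<noteq> \<zero>}"
    unfolding bij_betw_imp_surj_on[OF bij_coeff_vec, symmetric]
    using coeff_vec_in(3) by (auto simp: image_iff) 
  moreover have "inj_on (\<lambda>(S, C). coeff_vec S C) ({S \<in> support_sets K M. W \<in> S} \<times> coeff_seqs M F B)"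
    by (rule inj_on_subset[OF bij_betw_imp_inj_on[OF bij_coeff_vec[of K M]]]) blast
  ultimately show ?thesis by (simp add: bij_betw_def)
qed

text \<open>
  If \<open>v b \<noteq> \<zero>\<close>, the side information and \<open>transfer W b v\<close> differ at \<open>W\<close> only (in odd characteristic);
  otherwise the coefficient of \<open>W\<close> moves to \<open>b\<close>, and knowing \<open>X\<^sub>b\<close> isolates \<open>X\<^sub>W\<close>.
\<close>

definition transfer :: "nat \<Rightarrow> nat \<Rightarrow> (nat \<Rightarrow> nat) \<Rightarrow> nat \<Rightarrow> nat" where
  "transfer W b v = (if v b \<noteq> \<zero> then v(W := \<ominus> v W) else v(W := \<zero>, b := v W))"

lemma uminus_eq_zero_iff: "x \<in> B \<Longrightarrow> \<ominus> x = \<zero> \<longleftrightarrow> x = \<zero>"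
  using B_closed by (metis a_inv_closed minus_minus minus_zero)

lemma vecs_negate: "v \<in> vecs K M \<Longrightarrow> v(W := \<ominus> v W) \<in> vecs K M"
proof -
  assume v: "v \<in> vecs K M"
  then have "{i. (v(W := \<ominus> v W)) i \<noteq> \<zero>} = {i. v i \<noteq> \<zero>}"
    using uminus_eq_zero_iff by (auto simp: vecs_def)
  then show ?thesis using v uminus_B by (simp add: vecs_def)
qed

lemma vecs_move:
  assumes v: "v \<in> vecs K M" "v W \<noteq> \<zero>" "v b = \<zero>" "b \<in> {1..K}"
  shows "v(W := \<zero>, b := v W) \<in> vecs K M"
proof -
  let ?S = "{i. v i \<noteq> \<zero>}"
  have S: "?S \<in> support_sets K M" using v by (simp add: vecs_def)
  have eq: "{i. (v(W := \<zero>, b := v W)) i \<noteq> \<zero>} = insert b (?S - {W})"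
    using v by auto
  have "card (insert b (?S - {W})) = Suc (card ?S - 1)"
    using support_setsD[OF S] v by (subst card_insert_disjoint) auto
  also have "\<dots> = M" using support_setsD[OF S] v(2) card_gt_0_iff[of ?S] by auto
  finally have "insert b (?S - {W}) \<in> support_sets K M"
    using support_setsD[OF S] v(4) unfolding support_sets_def by auto
  then show ?thesis using v zero_B unfolding vecs_def mem_Collect_eq eq by auto
qed

text \<open>The image shows which branch was taken: its entry at \<open>W\<close> is nonzero after a
  negation and zero after a move, so either branch can be undone. For \<open>b = W\<close> it is
  always a negation. The target depends on \<open>b\<close> but not on \<open>W\<close>, which is
  the source of privacy.\<close>

lemma bij_transfer:
  assumes W: "W \<in> {1..K}" and b: "b \<in> {1..K}"
  shows "bij_betw (transfer W b) {v \<in> vecs K M. v W \<noteq> \<zero>} {u \<in> vecs K M. u b \<noteq> \<zero>}"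
proof (rule bij_betw_byWitness[where f' = "\<lambda>u. if u W \<noteq> \<zero> then u(W := \<ominus> u W) else u(b := \<zero>, W := u b)"])
  have B: "v i \<in> carrier F" "v i \<in> B" if "v \<in> vecs K M" for v i
    using that B_closed by (auto simp: vecs_def)
  have nz: "\<ominus> v i = \<zero> \<longleftrightarrow> v i = \<zero>" if "v \<in> vecs K M" for v i
    using uminus_eq_zero_iff B(2)[OF that] by blast
  show "\<forall>v\<in>{v \<in> vecs K M. v W \<noteq> \<zero>}.
      (if transfer W b v W \<noteq> \<zero> then (transfer W b v)(W := \<ominus> transfer W b v W)
       else (transfer W b v)(b := \<zero>, W := transfer W b v b)) = v"
    using B(1) nz by (auto simp: transfer_def fun_eq_iff)
  show "\<forall>u\<in>{u \<in> vecs K M. u b \<noteq> \<zero>}.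
      transfer W b (if u W \<noteq> \<zero> then u(W := \<ominus> u W) else u(b := \<zero>, W := u b)) = u"
    using B(1) nz by (auto simp: transfer_def fun_eq_iff)
  show "transfer W b ` {v \<in> vecs K M. v W \<noteq> \<zero>} \<subseteq> {u \<in> vecs K M. u b \<noteq> \<zero>}"
    using vecs_move[OF _ _ _ b] by (auto simp: transfer_def vecs_negate nz split: if_splits)
  show "(\<lambda>u. if u W \<noteq> \<zero> then u(W := \<ominus> u W) else u(b := \<zero>, W := u b)) ` {u \<in> vecs K M. u b \<noteq> \<zero>}
      \<subseteq> {v \<in> vecs K M. v W \<noteq> \<zero>}"
    using vecs_move[OF _ _ _ W] by (auto simp: vecs_negate nz)
qed

text \<open>
  Every natural number decodes to a query, so entries outside \<open>B\<close> are replaced by \<open>\<zero>\<close> to keep the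
  answer scalar-linear for all of them.
\<close>

definition row_entry :: "nat list \<Rightarrow> nat \<Rightarrow> nat" where
  "row_entry r i = (if r ! i \<in> B then r ! i else \<zero>)"

text \<open>The lists start at index \<open>0\<close> so that list positions and message indices
  agree.\<close>

definition encode_query :: "nat \<Rightarrow> (nat \<Rightarrow> nat) list \<Rightarrow> nat" where
  "encode_query K vs = to_nat (map (\<lambda>v. map v [0..<Suc K]) vs)"

text \<open>The frame shared by all three constructions. The rows asked for are given by
  \<open>g\<close> from the random index \<open>b\<close> and the transferred vector alone, so
  privacy holds for every \<open>g\<close>.\<close>

definition pivot_protocol :: "nat \<Rightarrow> (nat \<Rightarrow> (nat \<Rightarrow> nat) \<Rightarrow> (nat \<Rightarrow> nat) list) \<Rightarrow> protocol" where
  "pivot_protocol K g = \<lparr>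
     query_kernel = (\<lambda>W S C. map_pmf (\<lambda>b. encode_query K (g b (transfer W b (coeff_vec S C)))) (pmf_of_set {1..K})),
     answer_map = (\<lambda>Q _ X. map (\<lambda>r. dot K (row_entry r) X) (from_nat Q :: nat list list))\<rparr>"

lemma scalar_linear_pivot_protocol: "scalar_linear K F B (pivot_protocol K g)"
  unfolding scalar_linear_def
  by (rule exI[of _ "\<lambda>Q. map row_entry (from_nat Q)"])
    (auto simp: pivot_protocol_def dot_def row_entry_def zero_B)

lemma answer_pivot_protocol:
  assumes vs: "\<And>v. v \<in> set vs \<Longrightarrow> range v \<subseteq> B" and X: "X \<in> message_vectors K F"
  shows "answer_map (pivot_protocol K g) (encode_query K vs) c X = map (\<lambda>v. dot K v X) vs"
proof -
  have "dot K (row_entry (map v [0..<Suc K])) X = dot K v X" if "v \<in> set vs" for v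
    unfolding dot_def
  proof (rule finsum_cong')
    show "(\<lambda>i. v i \<otimes> X i) \<in> {1..K} \<rightarrow> carrier F"
    proof (rule Pi_I)
      fix i assume "i \<in> {1..K}"
      moreover have "v i \<in> carrier F" using vs[OF that] B_closed by auto
      ultimately show "v i \<otimes> X i \<in> carrier F" using message_closed[OF X] by simp
    qed
    fix i assume "i \<in> {1..K}"
    then have "map v [0..<Suc K] ! i = v i" by (simp del: upt_Suc)
    then show "row_entry (map v [0..<Suc K]) i \<otimes> X i = v i \<otimes> X i"
      using vs[OF that] by (auto simp: row_entry_def)
  qed simp
  then show ?thesis by (simp add: pivot_protocol_def encode_query_def del: upt_Suc)
qed

text \<open>The pair of demand and query is computed to be a product of the uniform distribution and
  \<open>\<nu>\<close>, a distribution in which the demand does not occur.\<close>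

lemma W_privacy_pivot_protocol:
  assumes M: "1 \<le> M" "M \<le> K"
  shows "W_privacy K M F B (pivot_protocol K g)"
proof -
  define \<nu> where "\<nu> = do {
      b \<leftarrow> pmf_of_set {1..K};
      map_pmf (\<lambda>u. encode_query K (g b u)) (pmf_of_set {u \<in> vecs K M. u b \<noteq> \<zero>})
    }"
  let ?p = "joint_pmf K M F B (pivot_protocol K g)"
  let ?S = "\<lambda>W. {S \<in> support_sets K M. W \<in> S}"
  let ?C = "coeff_seqs M F B"
  have K: "{1..K} \<noteq> {}" using M by auto
  have "map_pmf (\<lambda>\<omega>. (demand \<omega>, query \<omega>)) ?p = do {
     S \<leftarrow> pmf_of_set (support_sets K M);
     W \<leftarrow> pmf_of_set S;
     C \<leftarrow> pmf_of_set ?C;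
     b \<leftarrow> pmf_of_set {1..K};
     return_pmf (W, encode_query K (g b (transfer W b (coeff_vec S C))))}"
    by (simp add: joint_pmf_def map_bind_pmf pivot_protocol_def bind_map_pmf)
  \<comment> \<open>The demand is uniform on all indices, and given the demand the support is
    uniform among those containing it.\<close>
  also have "\<dots> = do {
     W \<leftarrow> pmf_of_set {1..K};
     S \<leftarrow> pmf_of_set (?S W);
     C \<leftarrow> pmf_of_set ?C;
     b \<leftarrow> pmf_of_set {1..K};
     return_pmf (W, encode_query K (g b (transfer W b (coeff_vec S C))))}"
  proof (rule bind_pmf_of_set_swap)
    show "finite (?S W) \<and> card (?S W) = (K - 1) choose (M - 1)" if "W \<in> {1..K}" for W
      using card_support_sets_containing[OF that M(1)] finite_support_sets by auto
    show "finite S \<and> card S = M" if "S \<in> support_sets K M" for S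
      using support_setsD[OF that] by simp
    show "S \<in> support_sets K M \<and> W \<in> S \<longleftrightarrow> W \<in> {1..K} \<and> S \<in> ?S W" for S W
      using support_setsD(1) by blast
  qed (use M K in \<open>auto simp: finite_support_sets support_sets_nonempty\<close>)
  also have "\<dots> = pmf_of_set {1..K} \<bind> (\<lambda>W. map_pmf (Pair W) \<nu>)"
  proof (rule bind_pmf_cong[OF refl])
    fix W assume "W \<in> set_pmf (pmf_of_set {1..K})"
    then have W: "W \<in> {1..K}" using K by simp
    have ne: "?S W \<noteq> {}" "finite (?S W)"
      using card_support_sets_containing[OF W M(1)] M finite_support_sets
      by (auto dest: arg_cong[of "{}" _ card] simp del: Collect_empty_eq)
    \<comment> \<open>Given the demand, support and coefficients together form a uniform vector of
      weight \<open>M\<close> that is nonzero at \<open>W\<close>.\<close>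
    have unif: "pmf_of_set {v \<in> vecs K M. v W \<noteq> \<zero>}
        = pmf_of_set (?S W) \<bind> (\<lambda>S. map_pmf (coeff_vec S) (pmf_of_set ?C))"
    proof -
      have "pmf_of_set {v \<in> vecs K M. v W \<noteq> \<zero>} = map_pmf (\<lambda>(S, C). coeff_vec S C) (pmf_of_set (?S W \<times> ?C))"
        using ne finite_coeff_seqs coeff_seqs_nonempty
        by (intro map_pmf_of_set_bij_betw[OF bij_coeff_vec_containing, symmetric]) auto
      also have "pmf_of_set (?S W \<times> ?C) = pmf_of_set (?S W) \<bind> (\<lambda>S. map_pmf (Pair S) (pmf_of_set ?C))"
        using ne finite_coeff_seqs coeff_seqs_nonempty
        by (intro bind_pmf_of_set_Sigma[symmetric, where n = "card ?C"]) (auto simp: card_gt_0_iff)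
      finally show ?thesis by (simp add: map_bind_pmf pmf.map_comp o_def)
    qed
    have ne_v: "{v \<in> vecs K M. v W \<noteq> \<zero>} \<noteq> {}" "finite {v \<in> vecs K M. v W \<noteq> \<zero>}"
      using bij_coeff_vec_containing[of K M W] ne finite_coeff_seqs coeff_seqs_nonempty
        bij_betw_finite[OF bij_coeff_vec_containing[of K M W]]
      by (auto simp del: Collect_empty_eq dest!: bij_betw_imp_surj_on)
    have "do {
         S \<leftarrow> pmf_of_set (?S W);
         C \<leftarrow> pmf_of_set ?C;
         b \<leftarrow> pmf_of_set {1..K};
         return_pmf (W, encode_query K (g b (transfer W b (coeff_vec S C))))}
      = do {
         v \<leftarrow> pmf_of_set {v \<in> vecs K M. v W \<noteq> \<zero>};
         b \<leftarrow> pmf_of_set {1..K};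
         return_pmf (W, encode_query K (g b (transfer W b v)))}"
      unfolding unif by (simp add: bind_assoc_pmf bind_map_pmf)
    \<comment> \<open>Drawing \<open>b\<close> first makes the bijection \<open>transfer W b\<close>
      applicable for each fixed \<open>b\<close>.\<close>
    also have "\<dots> = do {
         b \<leftarrow> pmf_of_set {1..K};
         v \<leftarrow> pmf_of_set {v \<in> vecs K M. v W \<noteq> \<zero>};
         return_pmf (W, encode_query K (g b (transfer W b v)))}"
      by (rule bind_commute_pmf)
    also have "\<dots> = do {
         b \<leftarrow> pmf_of_set {1..K};
         u \<leftarrow> map_pmf (transfer W b) (pmf_of_set {v \<in> vecs K M. v W \<noteq> \<zero>});
         return_pmf (W, encode_query K (g b u))}"
      by (simp add: bind_map_pmf)
    also have "\<dots> = map_pmf (Pair W) \<nu>"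
      unfolding \<nu>_def map_bind_pmf
    proof (rule bind_pmf_cong[OF refl])
      fix b assume "b \<in> set_pmf (pmf_of_set {1..K})"
      then have b: "b \<in> {1..K}" using K by simp
      show "map_pmf (transfer W b) (pmf_of_set {v \<in> vecs K M. v W \<noteq> \<zero>}) \<bind>
          (\<lambda>u. return_pmf (W, encode_query K (g b u)))
        = map_pmf (Pair W) (map_pmf (\<lambda>u. encode_query K (g b u)) (pmf_of_set {u \<in> vecs K M. u b \<noteq> \<zero>}))"
        unfolding map_pmf_of_set_bij_betw[OF bij_transfer[OF W b] ne_v]
        by (simp add: map_pmf_def bind_assoc_pmf bind_return_pmf)
    qed
    finally show "do {
         S \<leftarrow> pmf_of_set (?S W);
         C \<leftarrow> pmf_of_set ?C;
         b \<leftarrow> pmf_of_set {1..K};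
         return_pmf (W, encode_query K (g b (transfer W b (coeff_vec S C))))} = map_pmf (Pair W) \<nu>" .
  qed
  also have "\<dots> = pair_pmf (pmf_of_set {1..K}) \<nu>"
    by (simp add: pair_pmf_def map_pmf_def)
  finally have J: "map_pmf (\<lambda>\<omega>. (demand \<omega>, query \<omega>)) ?p = pair_pmf (pmf_of_set {1..K}) \<nu>" .
  have "map_pmf demand ?p = pmf_of_set {1..K}" "map_pmf query ?p = \<nu>"
    using arg_cong[OF J, of "map_pmf fst"] arg_cong[OF J, of "map_pmf snd"]
    by (simp_all add: pmf.map_comp o_def map_fst_pair_pmf map_snd_pair_pmf)
  then show ?thesis
    unfolding W_privacy_iff[OF M] J by (simp add: pmf_pair)
qed

text \<open>By linearity, recoverability concerns the difference \<open>D\<close> of two message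
  vectors with equal side information and equal answers: all known linear forms vanish on
  \<open>D\<close>, and \<open>D W\<close> must vanish too.\<close>

lemma PIR_pivot_protocol:
  assumes M: "1 \<le> M" "M \<le> K"
    and B: "\<And>b u w. b \<in> {1..K} \<Longrightarrow> u \<in> vecs K M \<Longrightarrow> w \<in> set (g b u) \<Longrightarrow> range w \<subseteq> B"
    and decode: "\<And>W b v D. W \<in> {1..K} \<Longrightarrow> b \<in> {1..K} \<Longrightarrow> v \<in> vecs K M \<Longrightarrow> v W \<noteq> \<zero> \<Longrightarrow>
      D \<in> {1..K} \<rightarrow> carrier F \<Longrightarrow> dot K v D = \<zero> \<Longrightarrow>
      (\<And>u. u \<in> set (g b (transfer W b v)) \<Longrightarrow> dot K u D = \<zero>) \<Longrightarrow> D W = \<zero>"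
  shows "PIR_CSI_II K M F B (pivot_protocol K g)"
proof -
  have K: "{1..K} \<noteq> {}" using M by auto
  have "recoverability K M F B (pivot_protocol K g)"
    unfolding recoverability_iff[OF M]
  proof (intro ballI allI)
    fix S W C Q a
    assume S: "S \<in> support_sets K M" and WS: "W \<in> S" and C: "C \<in> coeff_seqs M F B"
      and Q: "Q \<in> set_pmf (query_kernel (pivot_protocol K g) W S C)"
    let ?v = "coeff_vec S C"
    have W: "W \<in> {1..K}" using WS support_setsD[OF S] by auto
    have v: "?v \<in> vecs K M" using bij_betw_imp_surj_on[OF bij_coeff_vec] S C by fastforce
    have vW: "?v W \<noteq> \<zero>" using coeff_vec_in(3)[OF S C] WS by simp
    obtain b where b: "b \<in> {1..K}" and Qb: "Q = encode_query K (g b (transfer W b ?v))"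
      using Q K by (auto simp: pivot_protocol_def)
    have t: "transfer W b ?v \<in> vecs K M"
      using bij_betw_imp_surj_on[OF bij_transfer[OF W b]] v vW by blast
    let ?vs = "g b (transfer W b ?v)"
    have vs: "range w \<subseteq> B" if "w \<in> set ?vs" for w by (rule B[OF b t that])
    have ans_eq: "answer_map (pivot_protocol K g) Q True X = map (\<lambda>v. dot K v X) ?vs"
      if "X \<in> message_vectors K F" for X
      unfolding Qb by (rule answer_pivot_protocol[OF vs that])
    show "determines {X \<in> message_vectors K F. answer_map (pivot_protocol K g) Q True X = a} W S C"
      unfolding determines_def
    proof (intro ballI impI)
      fix X X'
      assume "X \<in> {X \<in> message_vectors K F. answer_map (pivot_protocol K g) Q True X = a}"
        and "X' \<in> {X \<in> message_vectors K F. answer_map (pivot_protocol K g) Q True X = a}"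
        and Y: "side_info F S C X = side_info F S C X'"
      then have X: "X \<in> message_vectors K F" "X' \<in> message_vectors K F"
        and ans: "answer_map (pivot_protocol K g) Q True X = answer_map (pivot_protocol K g) Q True X'"
        by auto
      have cl: "X \<in> {1..K} \<rightarrow> carrier F" "X' \<in> {1..K} \<rightarrow> carrier F" using X message_closed by auto
      let ?D = "\<lambda>i. X i \<ominus> X' i"
      have D: "?D \<in> {1..K} \<rightarrow> carrier F" using cl by (auto simp: Pi_iff)
      have "?D W = \<zero>"
      proof (rule decode[OF W b v vW D])
        have "?v \<in> {1..K} \<rightarrow> carrier F" using coeff_vec_in(2)[OF S C] B_closed by auto
        then show "dot K ?v ?D = \<zero>"
          using Y cl by (intro dot_diff_eq_0) (simp_all only: side_info_eq_dot[OF S C])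
        fix u assume u: "u \<in> set ?vs"
        have "map (\<lambda>v. dot K v X) ?vs = map (\<lambda>v. dot K v X') ?vs"
          using ans unfolding ans_eq[OF X(1)] ans_eq[OF X(2)] .
        then have "dot K u X = dot K u X'" using u by simp
        moreover have "u \<in> {1..K} \<rightarrow> carrier F" using vs[OF u] B_closed by auto
        ultimately show "dot K u ?D = \<zero>" using cl by (intro dot_diff_eq_0)
      qed
      then show "X W = X' W" using cl W by (auto simp: Pi_iff r_right_minus_eq)
    qed
  qed
  then show ?thesis using W_privacy_pivot_protocol[OF M] by (simp add: PIR_CSI_II_def)
qed

text \<open>An answer consists of \<open>m\<close> field elements, so there are at most
  \<open>card (carrier F) ^ m\<close> of them and the entropy is at most \<open>m\<close> times that
  of a message.\<close>

lemma rate_pivot_protocol: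
  assumes M: "2 \<le> M" "M \<le> K" and P: "PIR_CSI_II K M F B (pivot_protocol K g)"
    and B: "\<And>b u w. b \<in> {1..K} \<Longrightarrow> u \<in> vecs K M \<Longrightarrow> w \<in> set (g b u) \<Longrightarrow> range w \<subseteq> B"
    and len: "\<And>b u. length (g b u) = m" and m: "0 < m"
  shows "1 / real m \<le> rate K M q l F B (pivot_protocol K g)"
proof (rule rate_ge[OF M P _ _ _ m])
  let ?R = "{xs. set xs \<subseteq> carrier F \<and> length xs = m}"
  show "finite ?R" "card ?R \<le> card (carrier F) ^ m"
    using finite_F by (simp_all add: finite_lists_length_eq card_lists_length_eq)
  have M': "1 \<le> M" and K: "{1..K} \<noteq> {}" using M by auto
  show "answer (pivot_protocol K g) ` set_pmf (joint_pmf K M F B (pivot_protocol K g)) \<subseteq> ?R"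
  proof (rule image_subsetI)
    fix \<omega> assume "\<omega> \<in> set_pmf (joint_pmf K M F B (pivot_protocol K g))"
    then obtain W S C Q X where S: "S \<in> support_sets K M" "W \<in> S" "C \<in> coeff_seqs M F B"
      and Q: "Q \<in> set_pmf (query_kernel (pivot_protocol K g) W S C)" and X: "X \<in> message_vectors K F"
      and \<omega>: "answer (pivot_protocol K g) \<omega> = answer_map (pivot_protocol K g) Q True X"
      by (auto simp: set_joint_pmf[OF M' M(2)] answer_def demand_in_support_def)
    have W: "W \<in> {1..K}" using S support_setsD[OF S(1)] by auto
    let ?v = "coeff_vec S C"
    obtain b where b: "b \<in> {1..K}" and Qb: "Q = encode_query K (g b (transfer W b ?v))"
      using Q K by (auto simp: pivot_protocol_def)
    have "?v \<in> vecs K M" using bij_betw_imp_surj_on[OF bij_coeff_vec] S by fastforce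
    moreover have "?v W \<noteq> \<zero>" using coeff_vec_in(3)[OF S(1,3)] S by simp
    ultimately have t: "transfer W b ?v \<in> vecs K M"
      using bij_betw_imp_surj_on[OF bij_transfer[OF W b]] by blast
    have vs: "range w \<subseteq> B" if "w \<in> set (g b (transfer W b ?v))" for w by (rule B[OF b t that])
    have cl: "X \<in> {1..K} \<rightarrow> carrier F" using X message_closed by auto
    have "answer (pivot_protocol K g) \<omega> = map (\<lambda>v. dot K v X) (g b (transfer W b ?v))"
      unfolding \<omega> Qb by (rule answer_pivot_protocol[OF vs X])
    moreover have "dot K w X \<in> carrier F" if "w \<in> set (g b (transfer W b ?v))" for w
      using vs[OF that] B_closed cl by (intro dot_closed) auto
    ultimately show "answer (pivot_protocol K g) \<omega> \<in> ?R" by (auto simp: len)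
  qed
qed

section \<open>The three protocols and their decoding\<close>

abbreviation unit_vec :: "nat \<Rightarrow> nat \<Rightarrow> nat" where
  "unit_vec i \<equiv> (\<lambda>j. if j = i then \<one> else \<zero>)"

lemma vecs_closed: "v \<in> vecs K M \<Longrightarrow> v \<in> A \<rightarrow> carrier F"
  using B_closed by (auto simp: vecs_def)

lemma transfer_other: "i \<noteq> W \<Longrightarrow> i \<noteq> b \<Longrightarrow> transfer W b v i = v i"
  by (simp add: transfer_def)

lemma transfer_in_vecs:
  assumes "W \<in> {1..K}" "b \<in> {1..K}" "v \<in> vecs K M" "v W \<noteq> \<zero>"
  shows "transfer W b v \<in> vecs K M" "transfer W b v b \<noteq> \<zero>"
  using bij_betw_imp_surj_on[OF bij_transfer[OF assms(1,2)]] assms(3,4) by blast+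

lemma uminus_neq:
  assumes "\<one> \<oplus> \<one> \<noteq> \<zero>" "a \<in> carrier F" "a \<noteq> \<zero>"
  shows "\<ominus> a \<noteq> a"
proof
  assume "\<ominus> a = a"
  then have "a \<oplus> a = \<zero>" using assms(2) r_neg by metis
  moreover have "a \<otimes> (\<one> \<oplus> \<one>) = a \<oplus> a" using assms(2) by (simp add: r_distr)
  ultimately show False using assms integral[of a "\<one> \<oplus> \<one>"] by auto
qed

text \<open>The coefficient at \<open>W\<close> is either negated, which changes a nonzero element
  when \<open>2 \<noteq> 0\<close>, or replaced by zero.\<close>

lemma transfer_demand_neq:
  assumes "\<one> \<oplus> \<one> \<noteq> \<zero>" "v \<in> vecs K M" "v W \<noteq> \<zero>" "v b \<noteq> \<zero> \<or> b \<noteq> W"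
  shows "transfer W b v W \<noteq> v W"
  using assms uminus_neq[OF assms(1), of "v W"] vecs_closed[OF assms(2), of UNIV]
  by (auto simp: transfer_def Pi_iff)

text \<open>The second row reveals the message at \<open>b\<close>, which settles
  \<open>b = W\<close>. Otherwise the side information and the first row differ at \<open>W\<close>
  and at most at \<open>b\<close> besides, and the entry at \<open>b\<close> is known.\<close>

lemma two_row_protocol:
  assumes M: "2 \<le> M" "M \<le> K" and two: "\<one> \<oplus> \<one> \<noteq> \<zero>"
  shows "\<exists>P. PIR_CSI_II K M F B P \<and> scalar_linear K F B P \<and> 1 / 2 \<le> rate K M q l F B P"
proof -
  let ?g = "\<lambda>b u. [u, unit_vec b]"
  have B: "range w \<subseteq> B" if "b \<in> {1..K}" "u \<in> vecs K M" "w \<in> set (?g b u)" for b u w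
    using that zero_B one_B by (auto simp: vecs_def)
  have P: "PIR_CSI_II K M F B (pivot_protocol K ?g)"
  proof (rule PIR_pivot_protocol[OF _ _ B])
    fix W b v D
    assume *: "W \<in> {1..K}" "b \<in> {1..K}" "v \<in> vecs K M" "v W \<noteq> \<zero>" "D \<in> {1..K} \<rightarrow> carrier F" "dot K v D = \<zero>"
      and g: "\<And>u. u \<in> set (?g b (transfer W b v)) \<Longrightarrow> dot K u D = \<zero>"
    have Db: "D b = \<zero>" using g[of "unit_vec b"] dot_unit[OF *(5,2)] by simp
    show "D W = \<zero>"
    proof (cases "b = W")
      case False
      show ?thesis
      proof (rule dot_eq_0_cancel[OF vecs_closed[OF *(3)] vecs_closed[OF transfer_in_vecs(1)[OF *(1-4)]] *(5,6)])
        show "dot K (transfer W b v) D = \<zero>" by (rule g) simp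
        show "v W \<noteq> transfer W b v W" using transfer_demand_neq[OF two *(3,4)] False by metis
        show "D i = \<zero> \<or> transfer W b v i = v i" if "i \<noteq> W" for i
          using Db transfer_other[OF that] by (cases "i = b") auto
      qed (rule *(1))
    qed (use Db in simp)
  qed (use M in auto)
  have "1 / real 2 \<le> rate K M q l F B (pivot_protocol K ?g)"
    by (rule rate_pivot_protocol[OF M P B]) auto
  with P scalar_linear_pivot_protocol show ?thesis by fastforce
qed

text \<open>With full support every transfer is a negation at \<open>W\<close>, so side information
  and answer already isolate the demanded message.\<close>

lemma one_row_protocol_full_support:
  assumes M: "2 \<le> M" "M = K" and two: "\<one> \<oplus> \<one> \<noteq> \<zero>"
  shows "\<exists>P. PIR_CSI_II K M F B P \<and> scalar_linear K F B P \<and> 1 \<le> rate K M q l F B P"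
proof -
  let ?g = "\<lambda>(b::nat) u. [u]"
  have B: "range w \<subseteq> B" if "b \<in> {1..K}" "u \<in> vecs K M" "w \<in> set (?g b u)" for b u w
    using that by (auto simp: vecs_def)
  have P: "PIR_CSI_II K M F B (pivot_protocol K ?g)"
  proof (rule PIR_pivot_protocol[OF _ _ B])
    fix W b v D
    assume *: "W \<in> {1..K}" "b \<in> {1..K}" "v \<in> vecs K M" "v W \<noteq> \<zero>" "D \<in> {1..K} \<rightarrow> carrier F" "dot K v D = \<zero>"
      and g: "\<And>u. u \<in> set (?g b (transfer W b v)) \<Longrightarrow> dot K u D = \<zero>"
    have "{i. v i \<noteq> \<zero>} = {1..K}"
      using *(3) M by (intro card_subset_eq) (auto simp: vecs_def support_sets_def)
    then have vb: "v b \<noteq> \<zero>" using *(2) by blast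
    show "D W = \<zero>"
    proof (rule dot_eq_0_cancel[OF vecs_closed[OF *(3)] vecs_closed[OF transfer_in_vecs(1)[OF *(1-4)]] *(5,6)])
      show "dot K (transfer W b v) D = \<zero>" by (rule g) simp
      show "v W \<noteq> transfer W b v W" using transfer_demand_neq[OF two *(3,4)] vb by metis
      show "D i = \<zero> \<or> transfer W b v i = v i" if "i \<noteq> W" for i
        using that vb by (simp add: transfer_def)
    qed (rule *(1))
  qed (use M in auto)
  have "1 / real 1 \<le> rate K M q l F B (pivot_protocol K ?g)"
    by (rule rate_pivot_protocol[OF _ _ P B]) (use M in auto)
  with P scalar_linear_pivot_protocol show ?thesis by fastforce
qed

text \<open>The revealed message is either the demanded one or the other one in the side
  information, which then gives the demanded one. No negation has to change a coefficient, so the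
  characteristic is arbitrary.\<close>

lemma one_row_protocol_support_2:
  assumes K: "2 \<le> K"
  shows "\<exists>P. PIR_CSI_II K 2 F B P \<and> scalar_linear K F B P \<and> 1 \<le> rate K 2 q l F B P"
proof -
  \<comment> \<open>Transferred vectors are nonzero at \<open>b\<close> and have weight two, so the
    choice is unique for them.\<close>
  define other where "other b u = (SOME i. i \<noteq> b \<and> u i \<noteq> \<zero>)" for b :: nat and u :: "nat \<Rightarrow> nat"
  have other: "other b u \<noteq> b" "u (other b u) \<noteq> \<zero>" "other b u \<in> {1..K}" if u: "u \<in> vecs K 2" for b u
  proof -
    have S: "{i. u i \<noteq> \<zero>} \<in> support_sets K 2" using u by (simp add: vecs_def)
    have "\<not> {i. u i \<noteq> \<zero>} \<subseteq> {b}"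
      using support_setsD[OF S] card_mono[of "{b}" "{i. u i \<noteq> \<zero>}"] by auto
    then have "\<exists>i. i \<noteq> b \<and> u i \<noteq> \<zero>" by auto
    from someI_ex[OF this] show "other b u \<noteq> b" "u (other b u) \<noteq> \<zero>" by (auto simp: other_def)
    then show "other b u \<in> {1..K}" using support_setsD[OF S] by auto
  qed
  let ?g = "\<lambda>b u. [unit_vec (other b u)]"
  have B: "range w \<subseteq> B" if "b \<in> {1..K}" "u \<in> vecs K 2" "w \<in> set (?g b u)" for b u w
    using that zero_B one_B by auto
  have P: "PIR_CSI_II K 2 F B (pivot_protocol K ?g)"
  proof (rule PIR_pivot_protocol[OF _ _ B])
    fix W b v D
    assume *: "W \<in> {1..K}" "b \<in> {1..K}" "v \<in> vecs K 2" "v W \<noteq> \<zero>" "D \<in> {1..K} \<rightarrow> carrier F" "dot K v D = \<zero>"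
      and g: "\<And>u. u \<in> set (?g b (transfer W b v)) \<Longrightarrow> dot K u D = \<zero>"
    define i where "i = other b (transfer W b v)"
    note i = other[OF transfer_in_vecs(1)[OF *(1-4)], of b, folded i_def]
    have Di: "D i = \<zero>" using g[of "unit_vec i"] dot_unit[OF *(5) i(3)] by (simp add: i_def)
    show "D W = \<zero>"
    proof (cases "i = W")
      case False
      then have "v i \<noteq> \<zero>" using i transfer_other[of i W b v] by simp
      have S: "{i. v i \<noteq> \<zero>} \<in> support_sets K 2" using *(3) by (simp add: vecs_def)
      have supp: "{W, i} = {i. v i \<noteq> \<zero>}"
        using support_setsD[OF S] \<open>v i \<noteq> \<zero>\<close> *(4) False by (intro card_subset_eq) auto
      show ?thesis
      \<comment> \<open>The zero vector is the second form: off \<open>W\<close> either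
        \<open>D\<close> or the coefficient vanishes.\<close>
      proof (rule dot_eq_0_cancel[OF vecs_closed[OF *(3)] _ *(5,6) dot_zero[OF *(5)] *(1,4)])
        show "D j = \<zero> \<or> \<zero> = v j" if "j \<noteq> W" for j
        proof (cases "j = i")
          case False
          then have "j \<notin> {W, i}" using that by simp
          then show ?thesis unfolding supp by simp
        qed (use Di in simp)
      qed auto
    qed (use Di in simp)
  qed (use K in auto)
  have "1 / real 1 \<le> rate K 2 q l F B (pivot_protocol K ?g)"
    by (rule rate_pivot_protocol[OF _ _ P B]) (use K in auto)
  with P scalar_linear_pivot_protocol show ?thesis by fastforce
qed

end

section \<open>A field of odd characteristic\<close>

definition F3 :: "nat ring" where
  "F3 = \<lparr>carrier = {0, 1, 2}, mult = (\<lambda>x y. x * y mod 3), one = 1, zero = 0, add = (\<lambda>x y. (x + y) mod 3)\<rparr>"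

lemma cring_F3: "cring F3"
proof (rule cringI)
  show "abelian_group F3"
    by (rule abelian_groupI) (auto simp: F3_def)
  show "comm_monoid F3"
    by (rule comm_monoidI) (auto simp: F3_def)
  show "\<And>x y z. x \<in> carrier F3 \<Longrightarrow> y \<in> carrier F3 \<Longrightarrow> z \<in> carrier F3 \<Longrightarrow>
      (x \<oplus>\<^bsub>F3\<^esub> y) \<otimes>\<^bsub>F3\<^esub> z = x \<otimes>\<^bsub>F3\<^esub> z \<oplus>\<^bsub>F3\<^esub> y \<otimes>\<^bsub>F3\<^esub> z"
    by (auto simp: F3_def)
qed

lemma field_F3: "field F3"
proof -
  interpret cring F3 by (rule cring_F3)
  have "Units F3 = carrier F3 - {\<zero>\<^bsub>F3\<^esub>}"
    by (auto simp: Units_def F3_def)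
  then show ?thesis by (rule cring_fieldI)
qed

text \<open>The capacity is a supremum over all fields, so one field with
  \<open>2 \<noteq> 0\<close> suffices for achievability. With \<open>l = 1\<close> the subfield is
  the whole field.\<close>

lemma pir_field_F3: "pir_field F3 3 1 (carrier F3)"
proof -
  interpret field F3 by (rule field_F3)
  have "primepow (3::nat)" by (intro primepow_prime) simp
  then show ?thesis
    using field_F3 carrier_is_subfield
    by (auto simp: pir_field_def pir_field_axioms_def field_setting_def) (auto simp: F3_def)
qed

text \<open>Both capacities lie between the rate achieved over \<open>F3\<close> and the converse
  bound, which holds for every field.\<close>

lemma capacity_eqI:
  fixes n :: nat
  assumes M: "2 \<le> M" "M \<le> K" and n: "n = (if 3 \<le> M \<and> M < K then 2 else 1)"
    and ach: "\<exists>P. PIR_CSI_II K M F3 (carrier F3) P \<and> scalar_linear K F3 (carrier F3) P \<and>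
      1 / real n \<le> rate K M 3 1 F3 (carrier F3) P"
  shows "capacity K M = ereal (1 / real n)" "scalar_linear_capacity K M = ereal (1 / real n)"
proof -
  have "scalar_linear_capacity K M \<le> capacity K M"
    unfolding capacity_def scalar_linear_capacity_def by (rule Sup_subset_mono) blast
  moreover have "capacity K M \<le> ereal (1 / real n)"
    unfolding capacity_def
  proof (rule Sup_least, clarify)
    fix q l F B P assume fs: "field_setting q l F B" and P: "PIR_CSI_II K M F B P"
    interpret pir_field F q l B
      using fs by (simp add: pir_field_def pir_field_axioms_def field_setting_def)
    show "ereal (rate K M q l F B P) \<le> ereal (1 / real n)" using rate_le[OF M P n] by simp
  qed
  moreover have "ereal (1 / real n) \<le> scalar_linear_capacity K M"
  proof -
    obtain P where P: "PIR_CSI_II K M F3 (carrier F3) P" "scalar_linear K F3 (carrier F3) P"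
      "1 / real n \<le> rate K M 3 1 F3 (carrier F3) P" using ach by blast
    have "ereal (1 / real n) \<le> ereal (rate K M 3 1 F3 (carrier F3) P)" using P by simp
    also have "\<dots> \<le> scalar_linear_capacity K M"
      unfolding scalar_linear_capacity_def
      using P pir_field.field_setting[OF pir_field_F3] by (intro Sup_upper) blast
    finally show ?thesis .
  qed
  ultimately show "capacity K M = ereal (1 / real n)" "scalar_linear_capacity K M = ereal (1 / real n)"
    by auto
qed

theorem theorem4:
  fixes K M :: nat
  assumes "2 \<le> M" and "M \<le> K"
  shows "(M = 2 \<or> M = K \<longrightarrow> capacity K M = 1 \<and> scalar_linear_capacity K M = 1) \<and>
         (3 \<le> M \<and> M \<le> K - 1 \<longrightarrow>
            capacity K M = ereal (1 / 2) \<and> scalar_linear_capacity K M = ereal (1 / 2))"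
proof -
  interpret pir_field F3 3 1 "carrier F3" by (rule pir_field_F3)
  have two: "\<one>\<^bsub>F3\<^esub> \<oplus>\<^bsub>F3\<^esub> \<one>\<^bsub>F3\<^esub> \<noteq> \<zero>\<^bsub>F3\<^esub>" by (simp add: F3_def)
  show ?thesis
  proof (intro conjI impI)
    assume M: "M = 2 \<or> M = K"
    then have "\<exists>P. PIR_CSI_II K M F3 (carrier F3) P \<and> scalar_linear K F3 (carrier F3) P \<and>
      1 / real 1 \<le> rate K M 3 1 F3 (carrier F3) P"
      using one_row_protocol_support_2[of K] one_row_protocol_full_support[of M K] two assms by auto
    \<comment> \<open>Both \<open>M = 2\<close> and \<open>M = K\<close> violate
      \<open>3 \<le> M \<and> M < K\<close>, so \<open>n\<close> is \<open>1\<close>.\<close>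
    from capacity_eqI[OF assms _ this] M
    show "capacity K M = 1" "scalar_linear_capacity K M = 1" by (auto simp: one_ereal_def)
  next
    assume M: "3 \<le> M \<and> M \<le> K - 1"
    have "\<exists>P. PIR_CSI_II K M F3 (carrier F3) P \<and> scalar_linear K F3 (carrier F3) P \<and>
      1 / real 2 \<le> rate K M 3 1 F3 (carrier F3) P"
      using two_row_protocol[OF assms two] by simp
    from capacity_eqI[OF assms _ this] M
    show "capacity K M = ereal (1 / 2)" "scalar_linear_capacity K M = ereal (1 / 2)" by auto
  qed
qed

end
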